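(* Suppose that the data $(\{\xi^i\}_{i\ge1},h)$ satisfy: (i) $\xi^i\in L^2(\mathcal{F}^i_T)$ for each $i\ge 1$, and the $\xi^i$'s are independent copies of a random variable $\xi\in L^2(\mathcal{F}_T)$, with $\xi^1=\xi$; (ii) $h:\mathbb{R}\times\mathbb{R}\to\mathbb{R}$ satisfies $|h(y_1,z_1)-h(y_2,z_2)|\le \gamma_1|y_1-y_2|+\gamma_2|z_1-z_2|$ for all $y_1,y_2,z_1,z_2\in\mathbb{R}$, with positive constants $\gamma_1,\gamma_2$. Assume that $$\gamma_1^2+\gamma_2^2<\frac{1}{16}.$$ Let $\{Y^{i,n}\}_{1\le i\le n}$ and $\{Y^i\}_{i\ge1}$ be the value-processes of the interacting and of the mean-field optimal stopping systems defined in the context. Then $$\lim_{n\to\infty}\ \sup_{1\le i\le n}\ \mathbb{E}\Big[\sup_{t\in[0,T]}|Y^{i,n}_t-Y^i_t|^2\Big]=0.$$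
   Context: $(\Omega,\mathcal{F},\mathbb{P})$ is a complete probability space, $T>0$ is a finite horizon, $\{W^i\}_{i\ge1}$ are independent standard one-dimensional Brownian motions on it, $W:=W^1$. $\mathbb{F}^i=\{\mathcal{F}^i_t\}_{t\in[0,T]}$ is the $\mathbb{P}$-completed filtration generated by $W^i$, $\mathbb{F}=\{\mathcal{F}_t\}:=\mathbb{F}^1$; $\mathcal{T}^i_t$ is the set of $\mathbb{F}^i$-stopping times with values in $[t,T]$ a.s. $L^2(\mathcal{G})$ is the set of square-integrable $\mathcal{G}$-measurable random variables. $\mathcal{S}^2_c$ (relative to the filtration considered) is the space of continuous real-valued progressively measurable processes $y$ with $\mathbb{E}[\sup_{u\in[0,T]}|y_u|^2]<\infty$. For each $n$, $(Y^{1,n},\dots,Y^{n,n})$ is the unique solution (with $Y^{i,n}$ in $\mathcal{S}^2_c$, adapted to $\mathbb{F}^i$) of the interacting system $$Y^{i,n}_t=\operatorname*{ess\,sup}_{\tau\in\mathcal{T}^i_t}\mathbb{E}\Big[h\Big(Y^{i,n}_\tau,\frac1n\sum_{j=1}^nY^{j,n}_\tau\Big)\mathbf{1}_{\{\tau<T\}}+\xi^i\mathbf{1}_{\{\tau=T\}}\,\Big|\,\mathcal{F}^i_t\Big],\quad i=1,\dots,n,\ t\in[0,T],$$ and, for each $i\ge1$, $Y^i$ is the unique solution in $\mathcal{S}^2_c$ (adapted to $\mathbb{F}^i$) of $$Y^i_t=\operatorname*{ess\,sup}_{\tau\in\mathcal{T}^i_t}\mathbb{E}\big[h(Y^i_\tau,\mathbb{E}[Y^i_\tau])\mathbf{1}_{\{\tau<T\}}+\xi^i\mathbf{1}_{\{\tau=T\}}\,\big|\,\mathcal{F}^i_t\big],\quad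 t\in[0,T].$$ Here $\mathbb{E}[Y^i_\tau]$ is the expectation of the random variable $Y^i_\tau$ (not the function $s\mapsto\mathbb{E}[Y^i_s]$ evaluated at $s=\tau$). Existence and uniqueness of these solutions in $\mathcal{S}_c^2$ is known from the paper when $\gamma_1^2+\gamma_2^2<\tfrac12$. *)

theory Defs
  imports "HOL-Probability.Probability"
begin

text \<open>Brownian motion is only required on the finite horizon \<open>[0,T]\<close>; the values of the processes
  at other real times are irrelevant.\<close>

definition brownian_motion :: "'a measure \<Rightarrow> real \<Rightarrow> (real \<Rightarrow> 'a \<Rightarrow> real) \<Rightarrow> bool" where
  "brownian_motion M T W \<longleftrightarrow>
     (\<forall>t\<in>{0..T}. W t \<in> borel_measurable M) \<and>
     (AE \<omega> in M. W 0 \<omega> = 0) \<and>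
     (AE \<omega> in M. continuous_on {0..T} (\<lambda>t. W t \<omega>)) \<and>
     (\<forall>s t. 0 \<le> s \<longrightarrow> s < t \<longrightarrow> t \<le> T \<longrightarrow>
        distributed M lborel (\<lambda>\<omega>. W t \<omega> - W s \<omega>) (normal_density 0 (sqrt (t - s)))) \<and>
     (\<forall>n. \<forall>u :: nat \<Rightarrow> real. 0 \<le> u 0 \<longrightarrow> (\<forall>k<n. u k \<le> u (Suc k)) \<longrightarrow> u n \<le> T \<longrightarrow>
        prob_space.indep_vars M (\<lambda>_. borel) (\<lambda>k \<omega>. W (u (Suc k)) \<omega> - W (u k) \<omega>) {..<n})"

text \<open>Independence of the processes as a whole: they are independent random elements of the path
  space \<open>\<real>\<^bsup>[0,T]\<^esup>\<close>.\<close>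

definition indep_processes ::
    "'a measure \<Rightarrow> real \<Rightarrow> (nat \<Rightarrow> real \<Rightarrow> 'a \<Rightarrow> real) \<Rightarrow> nat set \<Rightarrow> bool" where
  "indep_processes M T W I \<longleftrightarrow>
     prob_space.indep_vars M (\<lambda>_. Pi\<^sub>M {0..T} (\<lambda>_. borel)) (\<lambda>i \<omega>. \<lambda>t\<in>{0..T}. W i t \<omega>) I"

text \<open>The completed filtration is indexed by all reals so that the library's \<open>stopping_time\<close>
  applies: it consists of the trivial events at negative times and is constant after \<open>T\<close>.\<close>

definition completed_filtration ::
    "'a measure \<Rightarrow> real \<Rightarrow> (real \<Rightarrow> 'a \<Rightarrow> real) \<Rightarrow> real \<Rightarrow> 'a measure" where
  "completed_filtration M T W t = sigma (space M)
     ({W s -` A \<inter> space M | s A. 0 \<le> s \<and> s \<le> min t T \<and> A \<in> sets borel} \<union> null_sets M)"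

definition stopping_times ::
    "'a measure \<Rightarrow> real \<Rightarrow> (real \<Rightarrow> 'a measure) \<Rightarrow> real \<Rightarrow> ('a \<Rightarrow> real) set" where
  "stopping_times M T F t =
     {\<tau>. stopping_time F \<tau> \<and> (AE \<omega> in M. t \<le> \<tau> \<omega> \<and> \<tau> \<omega> \<le> T)}"

definition square_integrable_rvs :: "'a measure \<Rightarrow> 'a measure \<Rightarrow> ('a \<Rightarrow> real) set" where
  "square_integrable_rvs M G = {X \<in> borel_measurable G. integrable M (\<lambda>\<omega>. (X \<omega>)\<^sup>2)}"

definition progressively_measurable ::
    "real \<Rightarrow> (real \<Rightarrow> 'a measure) \<Rightarrow> (real \<Rightarrow> 'a \<Rightarrow> real) \<Rightarrow> bool" where
  "progressively_measurable T F y \<longleftrightarrow>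
     (\<forall>t\<in>{0..T}. (\<lambda>(s, \<omega>). y s \<omega>) \<in> borel_measurable (restrict_space borel {0..t} \<Otimes>\<^sub>M F t))"

text \<open>The expectation of the (nonnegative) squared running supremum is taken in \<open>[0,\<infinity>]\<close>.\<close>

definition sup_sq_expectation :: "'a measure \<Rightarrow> real \<Rightarrow> (real \<Rightarrow> 'a \<Rightarrow> real) \<Rightarrow> ennreal" where
  "sup_sq_expectation M T y = (\<integral>\<^sup>+\<omega>. (SUP t\<in>{0..T}. ennreal (\<bar>y t \<omega>\<bar>\<^sup>2)) \<partial>M)"

definition S2c :: "'a measure \<Rightarrow> real \<Rightarrow> (real \<Rightarrow> 'a measure) \<Rightarrow> (real \<Rightarrow> 'a \<Rightarrow> real) set" where
  "S2c M T F = {y. progressively_measurable T F y \<and>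
     (AE \<omega> in M. continuous_on {0..T} (\<lambda>t. y t \<omega>)) \<and>
     sup_sq_expectation M T y < \<infinity>}"

text \<open>\<open>Z\<close> is (a version of) the essential supremum of the family \<open>\<X>\<close> of random variables:
  the least random variable, up to null sets, that dominates every member of the family.\<close>

definition is_ess_sup :: "'a measure \<Rightarrow> ('a \<Rightarrow> real) set \<Rightarrow> ('a \<Rightarrow> real) \<Rightarrow> bool" where
  "is_ess_sup M \<X> Z \<longleftrightarrow>
     Z \<in> borel_measurable M \<and>
     (\<forall>X\<in>\<X>. AE \<omega> in M. X \<omega> \<le> Z \<omega>) \<and>
     (\<forall>Z'\<in>borel_measurable M. (\<forall>X\<in>\<X>. AE \<omega> in M. X \<omega> \<le> Z' \<omega>) \<longrightarrow>
        (AE \<omega> in M. Z \<omega> \<le> Z' \<omega>))"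

definition payoff :: "real \<Rightarrow> ('a \<Rightarrow> real) \<Rightarrow> ('a \<Rightarrow> real) \<Rightarrow> ('a \<Rightarrow> real) \<Rightarrow> 'a \<Rightarrow> real" where
  "payoff T \<tau> H \<xi> \<omega> =
     H \<omega> * indicator {\<omega>. \<tau> \<omega> < T} \<omega> + \<xi> \<omega> * indicator {\<omega>. \<tau> \<omega> = T} \<omega>"

definition mean_field_system ::
    "'a measure \<Rightarrow> real \<Rightarrow> (real \<Rightarrow> 'a measure) \<Rightarrow> (real \<Rightarrow> real \<Rightarrow> real) \<Rightarrow> ('a \<Rightarrow> real)
      \<Rightarrow> (real \<Rightarrow> 'a \<Rightarrow> real) \<Rightarrow> bool" where
  "mean_field_system M T F h \<xi> Y \<longleftrightarrow>
     Y \<in> S2c M T F \<and>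
     (\<forall>t\<in>{0..T}. is_ess_sup M
        {real_cond_exp M (F t)
           (payoff T \<tau> (\<lambda>\<omega>. h (Y (\<tau> \<omega>) \<omega>) (\<integral>\<omega>'. Y (\<tau> \<omega>') \<omega>' \<partial>M)) \<xi>)
         | \<tau>. \<tau> \<in> stopping_times M T F t}
        (Y t))"

definition interacting_system ::
    "'a measure \<Rightarrow> real \<Rightarrow> (nat \<Rightarrow> real \<Rightarrow> 'a measure) \<Rightarrow> (real \<Rightarrow> real \<Rightarrow> real)
      \<Rightarrow> (nat \<Rightarrow> 'a \<Rightarrow> real) \<Rightarrow> nat \<Rightarrow> (nat \<Rightarrow> real \<Rightarrow> 'a \<Rightarrow> real) \<Rightarrow> bool" where
  "interacting_system M T F h \<xi> n Y \<longleftrightarrow>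
     (\<forall>i\<in>{1..n}.
        Y i \<in> S2c M T (F i) \<and>
        (\<forall>t\<in>{0..T}. is_ess_sup M
           {real_cond_exp M (F i t)
              (payoff T \<tau> (\<lambda>\<omega>. h (Y i (\<tau> \<omega>) \<omega>) (1 / real n * (\<Sum>j=1..n. Y j (\<tau> \<omega>) \<omega>))) (\<xi> i))
            | \<tau>. \<tau> \<in> stopping_times M T (F i) t}
           (Y i t)))"

end

theory Submission
  imports Defs
begin

text \<open>
  In both systems the value process is close to the martingale \<open>N\<^sub>t = E[\<xi> | F\<^sub>t]\<close> of the terminal
  value: stopping early never pays in the mean-field system, and pays in the interacting system only
  through the fluctuations of an average of \<open>n\<close> independent martingales.

  Let \<open>b = E[\<xi>]\<close>. In the mean-field system, stopping at a deterministic time \<open>t < T\<close> shows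
  \<open>h (Y\<^sub>t) (E[Y\<^sub>t]) \<le> Y\<^sub>t\<close>, and letting \<open>t\<close> tend to \<open>T\<close> along the continuous paths gives \<open>h \<xi> b \<le> \<xi>\<close>
  (\<open>mean_field_obstacle\<close>). Since \<open>h\<close> is a contraction in its first argument, the condition
  \<open>h y b \<le> y\<close> describes a half line (\<open>lipschitz_sub_fixpoints\<close>), so it passes to conditional
  expectations: \<open>h (N\<^sub>t) b \<le> N\<^sub>t\<close>. Against the frozen mean \<open>b\<close>, a stopper whose value is \<open>N\<close> has no
  reason to stop before \<open>T\<close>.

  Now let \<open>Y\<close> be the value process of a stopping problem whose mean-field argument stays within a
  random variable \<open>V\<close> of \<open>b\<close> at all stopping times, and let \<open>D\<close> be the supremum of \<open>\<bar>Y - N\<bar>\<close> over the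
  dyadic times. Optional stopping (\<open>optional_stopping_le\<close>) yields
  \<open>N\<^sub>t \<le> Y\<^sub>t \<le> N\<^sub>t + E[\<gamma>\<^sub>1 D + \<gamma>\<^sub>2 V | F\<^sub>t]\<close>. By Doob's inequality (\<open>Doob_L2_grid\<close>, which rests on the
  pathwise inequality \<open>pathwise_Doob\<close>) and \<open>\<gamma>\<^sub>1\<^sup>2 + \<gamma>\<^sub>2\<^sup>2 < 1/16\<close>, this gives \<open>E[D\<^sup>2] \<le> E[V\<^sup>2] / 3\<close>
  (\<open>martingale_gap_le\<close>). All suprema run over dyadic times because \<open>N\<^sub>t\<close> is given at each time only up
  to a null set; the continuity of \<open>Y\<close> does the rest.

  The estimate is applied twice. In the mean-field system the argument is \<open>E[Y\<^sub>\<tau>]\<close>, whose distance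
  from \<open>b\<close> is at most \<open>E[D]\<close>; with \<open>V = E[D]\<close> the estimate forces \<open>D = 0\<close>, so \<open>Y\<close> is the martingale
  (\<open>mean_field_value_is_martingale\<close>). In the interacting system \<open>V\<close> is the average of the gaps of all
  particles plus the maximum of the centred average of their martingales. The latter is a martingale
  in the joint filtration and has second moment at most four times \<open>Var \<xi> / n\<close>
  (\<open>martingale_average_bound\<close>). Averaging the estimate over the particles gives
  \<open>E[D\<^sub>i\<^sup>2] \<le> 8 * Var \<xi> / n\<close> for each of them (\<open>interacting_gap_bound\<close>), and since the particle and its
  mean-field counterpart are compared with the same martingale, this is a rate for the convergence.
\<close>

section \<open>Square-integrable random variables\<close>

abbreviation L2 :: "'a measure \<Rightarrow> ('a \<Rightarrow> real) set" where
  "L2 M \<equiv> square_integrable_rvs M M"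

lemma L2_iff: "f \<in> L2 M \<longleftrightarrow> f \<in> borel_measurable M \<and> integrable M (\<lambda>\<omega>. (f \<omega>)\<^sup>2)"
  by (simp add: square_integrable_rvs_def)

lemma L2_measurable: "f \<in> L2 M \<Longrightarrow> f \<in> borel_measurable M"
  and L2_square: "f \<in> L2 M \<Longrightarrow> integrable M (\<lambda>\<omega>. (f \<omega>)\<^sup>2)"
  by (simp_all add: L2_iff)

lemma L2_mult_integrable:
  assumes "f \<in> L2 M" "g \<in> L2 M"
  shows "integrable M (\<lambda>\<omega>. f \<omega> * g \<omega>)"
proof (rule Bochner_Integration.integrable_bound)
  show "integrable M (\<lambda>\<omega>. (f \<omega>)\<^sup>2 + (g \<omega>)\<^sup>2)"
    using assms by (simp add: L2_iff)
  show "(\<lambda>\<omega>. f \<omega> * g \<omega>) \<in> borel_measurable M"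
    using assms by (auto simp: L2_iff intro: borel_measurable_times)
  have "\<bar>x * y\<bar> \<le> \<bar>x\<^sup>2 + y\<^sup>2\<bar>" for x y :: real
  proof -
    have "0 \<le> (\<bar>x\<bar> - \<bar>y\<bar>)\<^sup>2" by simp
    then have "2 * (\<bar>x\<bar> * \<bar>y\<bar>) \<le> x\<^sup>2 + y\<^sup>2" by (simp add: power2_diff)
    moreover have "0 \<le> \<bar>x\<bar> * \<bar>y\<bar>" by simp
    ultimately have "\<bar>x\<bar> * \<bar>y\<bar> \<le> x\<^sup>2 + y\<^sup>2" by linarith
    then show ?thesis by (simp add: abs_mult)
  qed
  then show "AE \<omega> in M. norm (f \<omega> * g \<omega>) \<le> norm ((f \<omega>)\<^sup>2 + (g \<omega>)\<^sup>2)" by simp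
qed

lemma L2_bound:
  assumes "f \<in> L2 M" "g \<in> borel_measurable M" "AE \<omega> in M. \<bar>g \<omega>\<bar> \<le> \<bar>f \<omega>\<bar>"
  shows "g \<in> L2 M"
proof -
  have "integrable M (\<lambda>\<omega>. (g \<omega>)\<^sup>2)"
  proof (rule Bochner_Integration.integrable_bound[OF L2_square[OF assms(1)]])
    show "(\<lambda>\<omega>. (g \<omega>)\<^sup>2) \<in> borel_measurable M" using assms by simp
    show "AE \<omega> in M. norm ((g \<omega>)\<^sup>2) \<le> norm ((f \<omega>)\<^sup>2)"
      using assms(3) by eventually_elim (metis abs_ge_zero norm_power power_mono real_norm_def)
  qed
  with assms show ?thesis by (simp add: L2_iff)
qed

lemma L2_add:
  assumes "f \<in> L2 M" "g \<in> L2 M"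
  shows "(\<lambda>\<omega>. f \<omega> + g \<omega>) \<in> L2 M"
proof -
  have "integrable M (\<lambda>\<omega>. (f \<omega>)\<^sup>2 + (g \<omega>)\<^sup>2 + 2 * (f \<omega> * g \<omega>))"
    using L2_mult_integrable[OF assms] assms by (simp add: L2_iff)
  then show ?thesis using assms by (auto simp: L2_iff power2_sum mult.assoc intro: borel_measurable_add)
qed

lemma L2_cmult: "f \<in> L2 M \<Longrightarrow> (\<lambda>\<omega>. c * f \<omega>) \<in> L2 M"
  by (auto simp: L2_iff power_mult_distrib intro: borel_measurable_times)

lemma L2_diff:
  assumes "f \<in> L2 M" "g \<in> L2 M"
  shows "(\<lambda>\<omega>. f \<omega> - g \<omega>) \<in> L2 M"
  using L2_add[OF assms(1) L2_cmult[OF assms(2), of "-1"]] by simp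

lemma L2_abs: "f \<in> L2 M \<Longrightarrow> (\<lambda>\<omega>. \<bar>f \<omega>\<bar>) \<in> L2 M"
  by (auto simp: L2_iff)

lemma L2_sum: "(\<And>i. i \<in> I \<Longrightarrow> f i \<in> L2 M) \<Longrightarrow> (\<lambda>\<omega>. \<Sum>i\<in>I. f i \<omega>) \<in> L2 M"
proof (induction I rule: infinite_finite_induct)
  case (insert i I)
  then show ?case using L2_add[of "f i" M "\<lambda>\<omega>. \<Sum>i\<in>I. f i \<omega>"] by simp
qed (simp_all add: L2_iff)

lemma (in prob_space) L2_const: "(\<lambda>_. c) \<in> L2 M"
  by (simp add: L2_iff)

lemma (in prob_space) L2_integrable: "f \<in> L2 M \<Longrightarrow> integrable M f"
  using square_integrable_imp_integrable by (auto simp: L2_iff)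

lemma (in prob_space) L2_mean_sq_le:
  assumes "f \<in> L2 M"
  shows "(\<integral>\<omega>. f \<omega> \<partial>M)\<^sup>2 \<le> (\<integral>\<omega>. (f \<omega>)\<^sup>2 \<partial>M)"
  using variance_eq[OF L2_integrable[OF assms] L2_square[OF assms]] variance_positive[of f] by simp

lemma integrable_indicator_times:
  assumes "integrable M (f :: 'a \<Rightarrow> real)" "A \<in> sets M"
  shows "integrable M (\<lambda>\<omega>. indicator A \<omega> * f \<omega>)"
  using integrable_mult_indicator[OF assms(2,1)] by simp

section \<open>Doob's maximal inequality for discrete time\<close>

fun running_max :: "(nat \<Rightarrow> real) \<Rightarrow> nat \<Rightarrow> real" where
  "running_max x 0 = \<bar>x 0\<bar>"
| "running_max x (Suc n) = max (running_max x n) \<bar>x (Suc n)\<bar>"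

lemma abs_le_running_max: "k \<le> n \<Longrightarrow> \<bar>x k\<bar> \<le> running_max x n"
  by (induction n) (auto simp: le_Suc_eq intro: le_max_iff_disj[THEN iffD2])

lemma running_max_nonneg: "0 \<le> running_max x n"
  using abs_le_running_max[of 0 n x] by linarith

text \<open>Doob's inequality holds path by path: the sum on the left is the outcome of the betting strategy
  that holds the running maximum. In a step that keeps the maximum both sides change by the same amount; in
  a step where it grows from \<open>r\<close> to \<open>s\<close> the right-hand side gains \<open>(s - r)\<^sup>2 / 2\<close> over the left.\<close>

lemma pathwise_Doob:
  "(\<Sum>k<n. running_max x k * (\<bar>x (Suc k)\<bar> - \<bar>x k\<bar>)) \<le> running_max x n * \<bar>x n\<bar> - (running_max x n)\<^sup>2 / 2"
proof (induction n)
  case 0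
  then show ?case by (simp add: power2_eq_square)
next
  case (Suc n)
  let ?r = "running_max x n" and ?s = "\<bar>x (Suc n)\<bar>"
  have "?r * ?s - ?r\<^sup>2 / 2 \<le> max ?r ?s * ?s - (max ?r ?s)\<^sup>2 / 2"
  proof (cases "?s \<le> ?r")
    case False
    then have "max ?r ?s = ?s" by simp
    moreover have "0 \<le> (?s - ?r)\<^sup>2 / 2" by simp
    ultimately show ?thesis by (simp add: power2_diff power2_eq_square field_simps)
  qed (simp add: max_absorb1)
  with Suc show ?case by (simp add: algebra_simps)
qed

lemma pathwise_Doob_sq:
  "(running_max x n)\<^sup>2 + 4 * (\<Sum>k<n. running_max x k * (\<bar>x (Suc k)\<bar> - \<bar>x k\<bar>)) \<le> 4 * (x n)\<^sup>2"
proof -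
  \<comment> \<open>Completing the square turns the mixed term into the terminal value.\<close>
  have "0 \<le> (2 * \<bar>x n\<bar> - running_max x n)\<^sup>2" by simp
  then have "4 * (running_max x n * \<bar>x n\<bar>) - (running_max x n)\<^sup>2 \<le> 4 * (x n)\<^sup>2"
    by (simp add: power2_diff power_mult_distrib algebra_simps)
  then show ?thesis using pathwise_Doob[of x n] by linarith
qed

lemma running_max_measurable:
  assumes "\<And>k. k \<le> n \<Longrightarrow> X k \<in> borel_measurable N"
  shows "(\<lambda>\<omega>. running_max (\<lambda>k. X k \<omega>) n) \<in> borel_measurable N"
  using assms by (induction n) auto

lemma running_max_L2:
  assumes "\<And>k. k \<le> n \<Longrightarrow> X k \<in> L2 M"
  shows "(\<lambda>\<omega>. running_max (\<lambda>k. X k \<omega>) n) \<in> L2 M"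
  using assms
proof (induction n)
  case 0
  then show ?case by (simp add: L2_abs)
next
  case (Suc n)
  have "(\<lambda>\<omega>. running_max (\<lambda>k. X k \<omega>) n + \<bar>X (Suc n) \<omega>\<bar>) \<in> L2 M"
    using Suc by (intro L2_add L2_abs) auto
  moreover have "(\<lambda>\<omega>. running_max (\<lambda>k. X k \<omega>) (Suc n)) \<in> borel_measurable M"
    using Suc by (intro running_max_measurable L2_measurable) auto
  ultimately show ?case
    by (rule L2_bound) (auto simp: running_max_nonneg abs_of_nonneg le_max_iff_disj)
qed

text \<open>Take expectations in the pathwise inequality. The betting term has nonnegative mean because
  \<open>\<bar>X\<bar>\<close> is a submartingale, that is \<open>\<bar>x'\<bar> - \<bar>x\<bar> \<ge> sgn x * (x' - x)\<close>, and the running maximum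
  times \<open>sgn X\<close> is known one step ahead. Adaptedness is required
  only before the index \<open>K\<close>, so that \<open>X K\<close> can be any variable that closes the martingale.\<close>

lemma (in prob_space) Doob_L2_discrete:
  assumes sub: "\<And>k. k < K \<Longrightarrow> subalgebra M (G k)"
    and adapted: "\<And>j k. j \<le> k \<Longrightarrow> k < K \<Longrightarrow> X j \<in> borel_measurable (G k)"
    and sq: "\<And>k. k \<le> K \<Longrightarrow> X k \<in> L2 M"
    and mart: "\<And>k A. k < K \<Longrightarrow> A \<in> sets (G k) \<Longrightarrow>
        (\<integral>\<omega>. indicator A \<omega> * X (Suc k) \<omega> \<partial>M) = (\<integral>\<omega>. indicator A \<omega> * X k \<omega> \<partial>M)"
  shows "(\<integral>\<omega>. (running_max (\<lambda>k. X k \<omega>) K)\<^sup>2 \<partial>M) \<le> 4 * (\<integral>\<omega>. (X K \<omega>)\<^sup>2 \<partial>M)"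
proof -
  let ?R = "\<lambda>k \<omega>. running_max (\<lambda>k. X k \<omega>) k"
  have R: "?R k \<in> L2 M" if "k \<le> K" for k
    using that sq by (intro running_max_L2) auto
  have int: "integrable M (\<lambda>\<omega>. ?R k \<omega> * (\<bar>X (Suc k) \<omega>\<bar> - \<bar>X k \<omega>\<bar>))" if "k < K" for k
    using that by (intro L2_mult_integrable R L2_diff L2_abs sq) auto
  have pos: "0 \<le> (\<integral>\<omega>. ?R k \<omega> * (\<bar>X (Suc k) \<omega>\<bar> - \<bar>X k \<omega>\<bar>) \<partial>M)" if k: "k < K" for k
  proof -
    interpret fs: finite_measure_subalgebra M "G k"
      by unfold_locales (rule sub[OF k])
    have XS: "X (Suc k) \<in> L2 M" "X k \<in> L2 M" using k by (auto intro: sq)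
    have ce: "AE \<omega> in M. real_cond_exp M (G k) (X (Suc k)) \<omega> = X k \<omega>"
      using mart[OF k] XS k by (intro fs.real_cond_exp_charact)
        (auto simp: set_lebesgue_integral_def intro: L2_integrable adapted)
    let ?f = "\<lambda>\<omega>. ?R k \<omega> * sgn (X k \<omega>)"
    have fm: "?f \<in> borel_measurable (G k)"
      using k by (intro borel_measurable_times running_max_measurable
          measurable_compose[OF _ borel_measurable_sgn] adapted) auto
    have fL: "?f \<in> L2 M"
      using R[of k] k fm by (intro L2_bound[OF R[of k]])
        (auto simp: abs_mult sgn_real_def running_max_nonneg intro: measurable_from_subalg[OF sub])
    have "(\<integral>\<omega>. ?f \<omega> * X (Suc k) \<omega> \<partial>M) = (\<integral>\<omega>. ?f \<omega> * real_cond_exp M (G k) (X (Suc k)) \<omega> \<partial>M)"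
      by (rule fs.real_cond_exp_intg(2)[symmetric])
        (use fL XS fm in \<open>auto intro: L2_mult_integrable L2_measurable\<close>)
    also have "\<dots> = (\<integral>\<omega>. ?f \<omega> * X k \<omega> \<partial>M)"
      using ce fL XS by (intro integral_cong_AE) (auto intro: L2_measurable borel_measurable_times borel_measurable_cond_exp2)
    finally have "0 = (\<integral>\<omega>. ?f \<omega> * (X (Suc k) \<omega> - X k \<omega>) \<partial>M)"
      using L2_mult_integrable[OF fL XS(1)] L2_mult_integrable[OF fL XS(2)]
      by (simp add: right_diff_distrib)
    also have "\<dots> \<le> (\<integral>\<omega>. ?R k \<omega> * (\<bar>X (Suc k) \<omega>\<bar> - \<bar>X k \<omega>\<bar>) \<partial>M)"
    proof (rule integral_mono[OF L2_mult_integrable[OF fL L2_diff[OF XS]] int[OF k]])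
      fix \<omega>
      have "sgn (X k \<omega>) * (X (Suc k) \<omega> - X k \<omega>) \<le> \<bar>X (Suc k) \<omega>\<bar> - \<bar>X k \<omega>\<bar>"
        by (auto simp: sgn_real_def)
      then show "?f \<omega> * (X (Suc k) \<omega> - X k \<omega>) \<le> ?R k \<omega> * (\<bar>X (Suc k) \<omega>\<bar> - \<bar>X k \<omega>\<bar>)"
        unfolding mult.assoc by (rule mult_left_mono[OF _ running_max_nonneg])
    qed
    finally show ?thesis .
  qed
  let ?S = "\<lambda>\<omega>. \<Sum>k<K. ?R k \<omega> * (\<bar>X (Suc k) \<omega>\<bar> - \<bar>X k \<omega>\<bar>)"
  have S: "integrable M ?S" using int by (intro Bochner_Integration.integrable_sum) auto
  have "(\<integral>\<omega>. (?R K \<omega>)\<^sup>2 \<partial>M) \<le>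
      (\<integral>\<omega>. (?R K \<omega>)\<^sup>2 \<partial>M) + 4 * (\<Sum>k<K. \<integral>\<omega>. ?R k \<omega> * (\<bar>X (Suc k) \<omega>\<bar> - \<bar>X k \<omega>\<bar>) \<partial>M)"
    using sum_nonneg[of "{..<K}", OF pos] by simp
  also have "\<dots> = (\<integral>\<omega>. (?R K \<omega>)\<^sup>2 + 4 * ?S \<omega> \<partial>M)"
    using int S L2_square[OF R[of K]] by (simp add: Bochner_Integration.integral_sum)
  also have "\<dots> \<le> (\<integral>\<omega>. 4 * (X K \<omega>)\<^sup>2 \<partial>M)"
    using S L2_square[OF R[of K]] L2_square[OF sq[of K]]
    by (intro integral_mono pathwise_Doob_sq) simp_all
  finally show ?thesis by simp
qed

section \<open>Almost sure equality and conditional expectation\<close>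

text \<open>A process stopped at a random time is only determined almost surely, since the time lies in the
  horizon only almost surely; completeness makes this harmless for measurability.\<close>

lemma (in complete_measure) measurable_AE_eq:
  assumes "f \<in> M \<rightarrow>\<^sub>M N" "AE \<omega> in M. f \<omega> = g \<omega>" "g \<in> space M \<rightarrow> space N"
  shows "g \<in> M \<rightarrow>\<^sub>M N"
proof (rule measurableI)
  fix A assume A: "A \<in> sets N"
  have "AE \<omega> in M. \<omega> \<in> f -` A \<inter> space M \<longleftrightarrow> \<omega> \<in> g -` A \<inter> space M"
    using assms(2) by eventually_elim auto
  then show "g -` A \<inter> space M \<in> sets M"
    using in_sets_AE[of "f -` A \<inter> space M" "g -` A \<inter> space M"] measurable_sets[OF assms(1) A] by auto
qed (use assms(3) in auto)

lemma (in sigma_finite_subalgebra) real_cond_exp_le_of_integral_le: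
  assumes f: "integrable M f" and g: "integrable M g"
    and le: "\<And>A. A \<in> sets F \<Longrightarrow> (\<integral>\<omega>. indicator A \<omega> * f \<omega> \<partial>M) \<le> (\<integral>\<omega>. indicator A \<omega> * g \<omega> \<partial>M)"
  shows "AE \<omega> in M. real_cond_exp M F f \<omega> \<le> real_cond_exp M F g \<omega>"
proof -
  let ?d = "\<lambda>\<omega>. real_cond_exp M F f \<omega> - real_cond_exp M F g \<omega>"
  define A where "A = {\<omega> \<in> space F. 0 < ?d \<omega>}"
  have AF: "A \<in> sets F" unfolding A_def by measurable
  then have AM: "A \<in> sets M" using subalg by (auto simp: subalgebra_def)
  have spc: "space F = space M" using subalg by (simp add: subalgebra_def)
  have int: "integrable M (\<lambda>\<omega>. indicator A \<omega> * ?d \<omega>)"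
    using AM f g by (intro integrable_indicator_times) auto
  have "(\<integral>\<omega>. indicator A \<omega> * ?d \<omega> \<partial>M) =
      (\<integral>\<omega>. indicator A \<omega> * real_cond_exp M F f \<omega> \<partial>M) - (\<integral>\<omega>. indicator A \<omega> * real_cond_exp M F g \<omega> \<partial>M)"
    using integrable_indicator_times[OF real_cond_exp_int(1)[OF f] AM]
      integrable_indicator_times[OF real_cond_exp_int(1)[OF g] AM] by (simp add: right_diff_distrib)
  also have "\<dots> = (\<integral>\<omega>. indicator A \<omega> * f \<omega> \<partial>M) - (\<integral>\<omega>. indicator A \<omega> * g \<omega> \<partial>M)"
    using real_cond_exp_intA[OF f AF] real_cond_exp_intA[OF g AF]
    by (simp add: set_lebesgue_integral_def)
  also have "\<dots> \<le> 0" using le[OF AF] by simp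
  finally have "(\<integral>\<omega>. indicator A \<omega> * ?d \<omega> \<partial>M) \<le> 0" .
  moreover have nn: "AE \<omega> in M. 0 \<le> indicator A \<omega> * ?d \<omega>"
    by (auto simp: A_def indicator_def)
  ultimately have "(\<integral>\<omega>. indicator A \<omega> * ?d \<omega> \<partial>M) = 0"
    using integral_nonneg_AE[OF nn] by linarith
  then have "AE \<omega> in M. indicator A \<omega> * ?d \<omega> = 0"
    using integral_nonneg_eq_0_iff_AE[OF int nn] by simp
  with AE_space show ?thesis
    by eventually_elim (auto simp: A_def indicator_def spc split: if_splits)
qed

lemma (in sigma_finite_subalgebra) real_cond_exp_indicator:
  assumes "integrable M f" "A \<in> sets F"
  shows "(\<integral>\<omega>. indicator A \<omega> * real_cond_exp M F f \<omega> \<partial>M) = (\<integral>\<omega>. indicator A \<omega> * f \<omega> \<partial>M)"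
  using real_cond_exp_intA[OF assms] by (simp add: set_lebesgue_integral_def)

lemma (in sigma_finite_subalgebra) real_cond_exp_L2:
  assumes "f \<in> L2 M" "integrable M f"
  shows "real_cond_exp M F f \<in> L2 M"
  using integrable_convex_cond_exp[of f UNIV undefined undefined power2] assms
  by (auto simp: L2_iff convex_power2)

section \<open>Suprema over the dyadic times\<close>

text \<open>Suprema over the horizon are taken over this countable dense set, so that they are measurable
  and make sense for conditional expectations, which are given at each time only up to null sets.\<close>

definition dyadic_grid :: "real \<Rightarrow> real set" where
  "dyadic_grid T = (\<Union>m. (\<lambda>k. T * real k / 2 ^ m) ` {..2 ^ m})"

text \<open>Rounding upwards keeps the rounded value of a stopping time a stopping time.\<close>

definition dyadic_up :: "real \<Rightarrow> nat \<Rightarrow> real \<Rightarrow> real" where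
  "dyadic_up T m s = T * of_int \<lceil>2 ^ m * s / T\<rceil> / 2 ^ m"

lemma dyadic_gridI: "k \<le> 2 ^ m \<Longrightarrow> T * real k / 2 ^ m \<in> dyadic_grid T"
  unfolding dyadic_grid_def by blast

lemma countable_dyadic_grid: "countable (dyadic_grid T)"
  unfolding dyadic_grid_def by auto

lemma dyadic_grid_subset:
  assumes "0 < T" shows "dyadic_grid T \<subseteq> {0..T}"
proof
  fix q assume "q \<in> dyadic_grid T"
  then obtain m k where q: "q = T * real k / 2 ^ m" "k \<le> 2 ^ m" by (auto simp: dyadic_grid_def)
  have "real k \<le> real (2 ^ m)" using q(2) by (rule of_nat_mono)
  then have "T * real k \<le> T * 2 ^ m" using assms by simp
  then have "T * real k / 2 ^ m \<le> T" by (simp add: divide_le_eq)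
  then show "q \<in> {0..T}" using assms q(1) by simp
qed

lemma dyadic_level_mono:
  "(\<lambda>k. T * real k / 2 ^ m) ` {..2 ^ m} \<subseteq> (\<lambda>k. T * real k / 2 ^ Suc m) ` {..2 ^ Suc m}"
proof
  fix q assume "q \<in> (\<lambda>k. T * real k / 2 ^ m) ` {..2 ^ m}"
  then obtain k where "q = T * real k / 2 ^ m" "k \<le> 2 ^ m" by auto
  then have "q = T * real (2 * k) / 2 ^ Suc m" "2 * k \<le> 2 ^ Suc m" by auto
  then show "q \<in> (\<lambda>k. T * real k / 2 ^ Suc m) ` {..2 ^ Suc m}" by blast
qed

lemma dyadic_up_bounds:
  assumes "0 < T"
  shows "s \<le> dyadic_up T m s" "dyadic_up T m s \<le> s + T / 2 ^ m"
proof -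
  define c where "c = real_of_int \<lceil>2 ^ m * s / T\<rceil>"
  have "2 ^ m * s / T \<le> c" "c \<le> 2 ^ m * s / T + 1" unfolding c_def by linarith+
  then have "2 ^ m * s \<le> T * c" "T * c \<le> 2 ^ m * s + T"
    using assms by (simp_all add: field_simps)
  then show "s \<le> dyadic_up T m s" "dyadic_up T m s \<le> s + T / 2 ^ m"
    unfolding dyadic_up_def c_def[symmetric] by (simp_all add: field_simps)
qed

lemma dyadic_up_tendsto:
  assumes "0 < T"
  shows "(\<lambda>m. dyadic_up T m s) \<longlonglongrightarrow> s"
proof (rule tendsto_sandwich[of "\<lambda>_. s" _ _ "\<lambda>m. s + T / 2 ^ m"])
  have "(\<lambda>m. s + T * (1 / 2) ^ m) \<longlonglongrightarrow> s + T * 0"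
    by (intro tendsto_intros LIMSEQ_power_zero) simp
  then show "(\<lambda>m. s + T / 2 ^ m) \<longlonglongrightarrow> s" by (simp add: power_divide)
  show "(\<lambda>_. s) \<longlonglongrightarrow> s" by simp
qed (use dyadic_up_bounds[OF assms] in auto)

lemma dyadic_up_index:
  assumes "0 < T" "0 \<le> s" "s \<le> T"
  obtains k where "k \<le> 2 ^ m" "\<lceil>2 ^ m * s / T\<rceil> = int k" "dyadic_up T m s = T * real k / 2 ^ m"
proof -
  have "0 \<le> 2 ^ m * s / T" "2 ^ m * s / T \<le> of_int (2 ^ m)"
    using assms by (simp_all add: field_simps)
  then have "0 \<le> \<lceil>2 ^ m * s / T\<rceil>" "\<lceil>2 ^ m * s / T\<rceil> \<le> 2 ^ m"
    by - (linarith, simp only: ceiling_le_iff)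
  then show ?thesis
    by (intro that[of "nat \<lceil>2 ^ m * s / T\<rceil>"]) (auto simp: dyadic_up_def nat_le_iff)
qed

lemma dyadic_up_grid:
  assumes "0 < T" "0 \<le> s" "s \<le> T"
  shows "dyadic_up T m s \<in> dyadic_grid T"
proof -
  obtain k where "k \<le> 2 ^ m" "dyadic_up T m s = T * real k / 2 ^ m"
    using dyadic_up_index[OF assms] by blast
  then show ?thesis by (simp add: dyadic_gridI)
qed

lemma dyadic_grid_dense_le:
  fixes f :: "real \<Rightarrow> real"
  assumes T: "0 < T" and cont: "continuous_on {0..T} f"
    and le: "\<And>q. q \<in> dyadic_grid T \<Longrightarrow> \<bar>f q\<bar> \<le> u" and s: "s \<in> {0..T}"
  shows "\<bar>f s\<bar> \<le> u"
proof -
  have g: "dyadic_up T m s \<in> dyadic_grid T" for m using dyadic_up_grid[OF T] s by auto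
  then have "(\<lambda>m. f (dyadic_up T m s)) \<longlonglongrightarrow> f s"
    using dyadic_grid_subset[OF T]
    by (intro continuous_on_tendsto_compose[OF cont dyadic_up_tendsto[OF T] s] always_eventually allI)
      blast
  then have "(\<lambda>m. \<bar>f (dyadic_up T m s)\<bar>) \<longlonglongrightarrow> \<bar>f s\<bar>" by (rule tendsto_rabs)
  then show ?thesis by (rule LIMSEQ_le_const2) (use le g in auto)
qed

text \<open>The supremum is formed in \<open>[0,\<infinity>]\<close> and then squashed to a real, so this is the grid supremum
  of \<open>\<bar>X q \<omega>\<bar>\<close> where that is finite, and the junk value 0 elsewhere.\<close>

definition grid_max :: "real \<Rightarrow> (real \<Rightarrow> 'a \<Rightarrow> real) \<Rightarrow> 'a \<Rightarrow> real" where
  "grid_max T X \<omega> = sqrt (enn2real (SUP q\<in>dyadic_grid T. ennreal ((X q \<omega>)\<^sup>2)))"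

lemma grid_sup_measurable:
  assumes "\<And>q. q \<in> dyadic_grid T \<Longrightarrow> X q \<in> borel_measurable M"
  shows "(\<lambda>\<omega>. SUP q\<in>dyadic_grid T. ennreal ((X q \<omega>)\<^sup>2)) \<in> borel_measurable M"
  using assms by (intro borel_measurable_SUP countable_dyadic_grid) auto

lemma grid_max_measurable:
  assumes "\<And>q. q \<in> dyadic_grid T \<Longrightarrow> X q \<in> borel_measurable M"
  shows "grid_max T X \<in> borel_measurable M"
  using grid_sup_measurable[of T X M] assms unfolding grid_max_def by simp

lemma grid_max_nonneg: "0 \<le> grid_max T X \<omega>"
  by (simp add: grid_max_def)

lemma grid_max_L2:
  assumes meas: "\<And>q. q \<in> dyadic_grid T \<Longrightarrow> X q \<in> borel_measurable M"
    and c: "0 \<le> c" and le: "(\<integral>\<^sup>+\<omega>. (SUP q\<in>dyadic_grid T. ennreal ((X q \<omega>)\<^sup>2)) \<partial>M) \<le> ennreal c"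
  shows "grid_max T X \<in> L2 M" "(\<integral>\<omega>. (grid_max T X \<omega>)\<^sup>2 \<partial>M) \<le> c"
    "AE \<omega> in M. \<forall>q\<in>dyadic_grid T. \<bar>X q \<omega>\<bar> \<le> grid_max T X \<omega>"
proof -
  let ?S = "\<lambda>\<omega>. SUP q\<in>dyadic_grid T. ennreal ((X q \<omega>)\<^sup>2)"
  have fin: "AE \<omega> in M. ?S \<omega> \<noteq> \<infinity>"
    by (rule nn_integral_noteq_infinite)
      (use grid_sup_measurable[OF meas] le in \<open>auto simp: top_unique\<close>)
  then have eq: "AE \<omega> in M. ennreal ((grid_max T X \<omega>)\<^sup>2) = ?S \<omega>"
  proof eventually_elim
    case (elim \<omega>)
    then have "ennreal (enn2real (?S \<omega>)) = ?S \<omega>"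
      by (intro ennreal_enn2real) (simp only: less_top infinity_ennreal_def not_False_eq_True)
    then show ?case by (simp add: grid_max_def)
  qed
  have "(\<integral>\<^sup>+\<omega>. ennreal ((grid_max T X \<omega>)\<^sup>2) \<partial>M) = (\<integral>\<^sup>+\<omega>. ?S \<omega> \<partial>M)"
    using eq by (rule nn_integral_cong_AE)
  then have nn: "(\<integral>\<^sup>+\<omega>. ennreal ((grid_max T X \<omega>)\<^sup>2) \<partial>M) \<le> ennreal c" using le by simp
  have m: "grid_max T X \<in> borel_measurable M" by (rule grid_max_measurable[OF meas])
  have "integrable M (\<lambda>\<omega>. (grid_max T X \<omega>)\<^sup>2)"
    using nn m by (intro integrableI_bounded) (auto intro: le_less_trans)
  with m show "grid_max T X \<in> L2 M" by (simp add: L2_iff)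
  show "(\<integral>\<omega>. (grid_max T X \<omega>)\<^sup>2 \<partial>M) \<le> c"
    using nn c m by (subst integral_eq_nn_integral) (auto intro: enn2real_leI)
  show "AE \<omega> in M. \<forall>q\<in>dyadic_grid T. \<bar>X q \<omega>\<bar> \<le> grid_max T X \<omega>"
    using eq
  proof eventually_elim
    case (elim \<omega>)
    show ?case
    proof
      fix q assume "q \<in> dyadic_grid T"
      then have "ennreal ((X q \<omega>)\<^sup>2) \<le> ennreal ((grid_max T X \<omega>)\<^sup>2)"
        unfolding elim by (rule SUP_upper)
      then have "(X q \<omega>)\<^sup>2 \<le> (grid_max T X \<omega>)\<^sup>2" by (simp add: ennreal_le_iff)
      then show "\<bar>X q \<omega>\<bar> \<le> grid_max T X \<omega>"
        using grid_max_nonneg by (metis abs_le_square_iff abs_of_nonneg)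
    qed
  qed
qed

text \<open>Each dyadic level is a discrete martingale closed by \<open>U\<close>; the levels increase to the grid, and
  monotone convergence passes the bound, which does not depend on the level, to the limit.\<close>

lemma (in prob_space) Doob_L2_grid:
  assumes T: "0 < T"
    and sub: "\<And>q. q \<in> {0..T} \<Longrightarrow> subalgebra M (G q)"
    and mono: "\<And>p q. 0 \<le> p \<Longrightarrow> p \<le> q \<Longrightarrow> q \<le> T \<Longrightarrow> sets (G p) \<subseteq> sets (G q)"
    and adapted: "\<And>q. q \<in> dyadic_grid T \<Longrightarrow> X q \<in> borel_measurable (G q)"
    and sq: "\<And>q. q \<in> dyadic_grid T \<Longrightarrow> X q \<in> L2 M" and U: "U \<in> L2 M"
    and closed: "\<And>q A. q \<in> dyadic_grid T \<Longrightarrow> A \<in> sets (G q) \<Longrightarrow>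
        (\<integral>\<omega>. indicator A \<omega> * X q \<omega> \<partial>M) = (\<integral>\<omega>. indicator A \<omega> * U \<omega> \<partial>M)"
  shows "(\<integral>\<^sup>+\<omega>. (SUP q\<in>dyadic_grid T. ennreal ((X q \<omega>)\<^sup>2)) \<partial>M) \<le> ennreal (4 * (\<integral>\<omega>. (U \<omega>)\<^sup>2 \<partial>M))"
proof -
  let ?t = "\<lambda>m k. T * real k / 2 ^ m"
  let ?L = "\<lambda>m \<omega>. SUP q\<in>?t m ` {..2 ^ m}. ennreal ((X q \<omega>)\<^sup>2)"
  have lv: "?t m k \<in> dyadic_grid T" if "k \<le> 2 ^ m" for m k by (rule dyadic_gridI[OF that])
  have le: "(\<integral>\<^sup>+\<omega>. ?L m \<omega> \<partial>M) \<le> ennreal (4 * (\<integral>\<omega>. (U \<omega>)\<^sup>2 \<partial>M))" for m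
  proof -
    \<comment> \<open>The level is continued by one step in which the terminal variable is revealed.\<close>
    define Z where "Z k = (if k \<le> 2 ^ m then X (?t m k) else U)" for k
    define K :: nat where "K = 2 ^ m + 1"
    let ?R = "\<lambda>\<omega>. running_max (\<lambda>k. Z k \<omega>) K"
    have Z: "Z k \<in> L2 M" for k using sq[OF lv] U by (simp add: Z_def)
    have sets_le: "sets (G (?t m j)) \<subseteq> sets (G (?t m k))" if "j \<le> k" "k \<le> 2 ^ m" for j k
    proof (rule mono)
      show "?t m j \<le> ?t m k" using that T by (simp add: divide_right_mono)
      show "?t m k \<le> T" using lv[OF that(2)] dyadic_grid_subset[OF T] by auto
    qed (use T in simp)
    have "(\<integral>\<omega>. (?R \<omega>)\<^sup>2 \<partial>M) \<le> 4 * (\<integral>\<omega>. (Z K \<omega>)\<^sup>2 \<partial>M)"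
    proof (rule Doob_L2_discrete[where G = "\<lambda>k. G (?t m k)"])
      show "subalgebra M (G (?t m k))" if "k < K" for k
        using that lv[of k m] dyadic_grid_subset[OF T] by (intro sub) (auto simp: K_def)
      show "Z j \<in> borel_measurable (G (?t m k))" if "j \<le> k" "k < K" for j k
      proof -
        have s: "subalgebra M (G (?t m i))" if "i \<le> 2 ^ m" for i
          using lv[OF that] dyadic_grid_subset[OF T] by (intro sub) auto
        have "subalgebra (G (?t m k)) (G (?t m j))"
          using sets_le[of j k] s[of j] s[of k] that by (auto simp: subalgebra_def K_def)
        moreover have "X (?t m j) \<in> borel_measurable (G (?t m j))"
          using that by (intro adapted lv) (simp add: K_def)
        ultimately have "X (?t m j) \<in> borel_measurable (G (?t m k))"
          by (rule measurable_from_subalg)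
        then show ?thesis using that by (simp add: Z_def K_def)
      qed
      show "(\<integral>\<omega>. indicator A \<omega> * Z (Suc k) \<omega> \<partial>M) = (\<integral>\<omega>. indicator A \<omega> * Z k \<omega> \<partial>M)"
        if "k < K" "A \<in> sets (G (?t m k))" for k A
      proof (cases "Suc k \<le> 2 ^ m")
        case True
        then show ?thesis
          using that closed[OF lv[OF True], of A] closed[OF lv[of k m], of A] sets_le[of k "Suc k"]
          by (auto simp: Z_def)
      next
        case False
        then show ?thesis using that closed[OF lv[of k m], of A] by (auto simp: Z_def K_def)
      qed
    qed (rule Z)
    then have R: "(\<integral>\<omega>. (?R \<omega>)\<^sup>2 \<partial>M) \<le> 4 * (\<integral>\<omega>. (U \<omega>)\<^sup>2 \<partial>M)" by (simp add: Z_def K_def)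
    have RL: "?R \<in> L2 M" by (rule running_max_L2[OF Z])
    have "(\<integral>\<^sup>+\<omega>. ?L m \<omega> \<partial>M) \<le> (\<integral>\<^sup>+\<omega>. ennreal ((?R \<omega>)\<^sup>2) \<partial>M)"
    proof (rule nn_integral_mono, rule SUP_least)
      fix \<omega> q assume "q \<in> ?t m ` {..2 ^ m}"
      then obtain k where k: "k \<le> 2 ^ m" "q = ?t m k" by auto
      have "\<bar>Z k \<omega>\<bar> \<le> ?R \<omega>" using k by (intro abs_le_running_max) (simp add: K_def)
      then have "(X q \<omega>)\<^sup>2 \<le> (?R \<omega>)\<^sup>2"
        using k power_mono[of "\<bar>X q \<omega>\<bar>" "?R \<omega>" 2] by (simp add: Z_def)
      then show "ennreal ((X q \<omega>)\<^sup>2) \<le> ennreal ((?R \<omega>)\<^sup>2)" by (rule ennreal_leI)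
    qed
    also have "\<dots> = ennreal (\<integral>\<omega>. (?R \<omega>)\<^sup>2 \<partial>M)"
      using L2_square[OF RL] by (intro nn_integral_eq_integral) auto
    also have "\<dots> \<le> ennreal (4 * (\<integral>\<omega>. (U \<omega>)\<^sup>2 \<partial>M))" using R by (rule ennreal_leI)
    finally show ?thesis .
  qed
  have "(\<integral>\<^sup>+\<omega>. (SUP q\<in>dyadic_grid T. ennreal ((X q \<omega>)\<^sup>2)) \<partial>M) = (\<integral>\<^sup>+\<omega>. (SUP m. ?L m \<omega>) \<partial>M)"
    unfolding dyadic_grid_def by (simp add: SUP_UNION)
  also have "\<dots> = (SUP m. \<integral>\<^sup>+\<omega>. ?L m \<omega> \<partial>M)"
  proof (rule nn_integral_monotone_convergence_SUP)
    show "incseq ?L"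
      by (rule incseq_SucI, rule le_funI, rule SUP_subset_mono[OF dyadic_level_mono]) simp
    show "?L m \<in> borel_measurable M" for m
      using sq[OF lv] by (intro borel_measurable_SUP) (auto dest!: L2_measurable intro!: measurable_compose[OF _ measurable_ennreal] borel_measurable_power)
  qed
  also have "\<dots> \<le> ennreal (4 * (\<integral>\<omega>. (U \<omega>)\<^sup>2 \<partial>M))" by (rule SUP_least) (rule le)
  finally show ?thesis .
qed

lemma grid_max_dominated:
  assumes meas: "\<And>q. q \<in> dyadic_grid T \<Longrightarrow> X q \<in> borel_measurable M" and B: "B \<in> L2 M"
    and le: "\<And>q. q \<in> dyadic_grid T \<Longrightarrow> AE \<omega> in M. \<bar>X q \<omega>\<bar> \<le> B \<omega>"
  shows "grid_max T X \<in> L2 M" "AE \<omega> in M. \<forall>q\<in>dyadic_grid T. \<bar>X q \<omega>\<bar> \<le> grid_max T X \<omega>"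
proof -
  have "AE \<omega> in M. \<forall>q\<in>dyadic_grid T. \<bar>X q \<omega>\<bar> \<le> B \<omega>"
    using le countable_dyadic_grid by (simp add: AE_ball_countable)
  then have "(\<integral>\<^sup>+\<omega>. (SUP q\<in>dyadic_grid T. ennreal ((X q \<omega>)\<^sup>2)) \<partial>M) \<le> (\<integral>\<^sup>+\<omega>. ennreal ((B \<omega>)\<^sup>2) \<partial>M)"
  proof (intro nn_integral_mono_AE, eventually_elim)
    case (elim \<omega>)
    have "(X q \<omega>)\<^sup>2 \<le> (B \<omega>)\<^sup>2" if "q \<in> dyadic_grid T" for q
      using elim that power_mono[of "\<bar>X q \<omega>\<bar>" "B \<omega>" 2] by simp
    then show ?case by (intro SUP_least ennreal_leI)
  qed
  also have "\<dots> = ennreal (\<integral>\<omega>. (B \<omega>)\<^sup>2 \<partial>M)"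
    using L2_square[OF B] by (intro nn_integral_eq_integral) auto
  finally have le': "(\<integral>\<^sup>+\<omega>. (SUP q\<in>dyadic_grid T. ennreal ((X q \<omega>)\<^sup>2)) \<partial>M) \<le> \<dots>" .
  show "grid_max T X \<in> L2 M" "AE \<omega> in M. \<forall>q\<in>dyadic_grid T. \<bar>X q \<omega>\<bar> \<le> grid_max T X \<omega>"
    using grid_max_L2[OF meas _ le'] by simp_all
qed

section \<open>Continuous processes and stopping times of a complete filtration\<close>

text \<open>The time index runs over all reals because stopping times are taken with respect to such
  filtrations.\<close>

locale complete_filtered_space = prob_space M + complete_measure M for M :: "'a measure" +
  fixes F :: "real \<Rightarrow> 'a measure" and T :: real
  assumes T_pos: "0 < T"
    and sub: "\<And>t. subalgebra M (F t)"
    and F_mono: "\<And>s t. s \<le> t \<Longrightarrow> sets (F s) \<subseteq> sets (F t)"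
    and null_F: "\<And>t. null_sets M \<subseteq> sets (F t)"
begin

lemma sigma_finite_subalgebra_F: "sigma_finite_subalgebra M (F t)"
proof -
  interpret finite_measure_subalgebra M "F t" by unfold_locales (rule sub)
  show ?thesis by unfold_locales
qed

lemma F_sets: "A \<in> sets (F t) \<Longrightarrow> A \<in> sets M"
  using sub[of t] by (auto simp: subalgebra_def)

lemma F_space: "space (F t) = space M"
  using sub[of t] by (simp add: subalgebra_def)

lemma F_measurable: "f \<in> borel_measurable (F t) \<Longrightarrow> f \<in> borel_measurable M"
  by (rule measurable_from_subalg[OF sub])

lemma grid_le_T: "q \<in> dyadic_grid T \<Longrightarrow> q \<in> {0..T}"
  using dyadic_grid_subset[OF T_pos] by auto

lemma S2c_adapted:
  assumes "Y \<in> S2c M T F" "t \<in> {0..T}"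
  shows "Y t \<in> borel_measurable (F t)"
proof -
  have "(\<lambda>(s, \<omega>). Y s \<omega>) \<in> borel_measurable (restrict_space borel {0..t} \<Otimes>\<^sub>M F t)"
    using assms by (auto simp: S2c_def progressively_measurable_def)
  then have "(\<lambda>\<omega>. case (t, \<omega>) of (s, \<omega>) \<Rightarrow> Y s \<omega>) \<in> borel_measurable (F t)"
    by (rule measurable_compose_Pair1[rotated]) (use assms(2) in \<open>simp add: space_restrict_space\<close>)
  then show ?thesis by simp
qed

lemma S2c_measurable: "Y \<in> S2c M T F \<Longrightarrow> t \<in> {0..T} \<Longrightarrow> Y t \<in> borel_measurable M"
  by (rule F_measurable[OF S2c_adapted])

lemma S2c_continuous: "Y \<in> S2c M T F \<Longrightarrow> AE \<omega> in M. continuous_on {0..T} (\<lambda>t. Y t \<omega>)"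
  by (simp add: S2c_def)

lemma S2c_grid_max:
  assumes Y: "Y \<in> S2c M T F"
  shows "grid_max T Y \<in> L2 M" "AE \<omega> in M. \<forall>t\<in>{0..T}. \<bar>Y t \<omega>\<bar> \<le> grid_max T Y \<omega>"
proof -
  let ?e = "sup_sq_expectation M T Y"
  have meas: "Y q \<in> borel_measurable M" if "q \<in> dyadic_grid T" for q
    by (rule S2c_measurable[OF Y grid_le_T[OF that]])
  have "(\<integral>\<^sup>+\<omega>. (SUP q\<in>dyadic_grid T. ennreal ((Y q \<omega>)\<^sup>2)) \<partial>M) \<le> ?e"
    unfolding sup_sq_expectation_def power2_abs
    by (intro nn_integral_mono SUP_subset_mono dyadic_grid_subset T_pos) simp
  also have "?e = ennreal (enn2real ?e)"
    using Y by (simp add: S2c_def)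
  finally have le: "(\<integral>\<^sup>+\<omega>. (SUP q\<in>dyadic_grid T. ennreal ((Y q \<omega>)\<^sup>2)) \<partial>M) \<le> \<dots>" .
  show "grid_max T Y \<in> L2 M" using grid_max_L2(1)[OF meas _ le] by simp
  have "AE \<omega> in M. \<forall>q\<in>dyadic_grid T. \<bar>Y q \<omega>\<bar> \<le> grid_max T Y \<omega>"
    using grid_max_L2(3)[OF meas _ le] by simp
  with S2c_continuous[OF Y] show "AE \<omega> in M. \<forall>t\<in>{0..T}. \<bar>Y t \<omega>\<bar> \<le> grid_max T Y \<omega>"
  proof eventually_elim
    case (elim \<omega>)
    show ?case
      by (rule ballI, rule dyadic_grid_dense_le[OF T_pos elim(1)]) (use elim(2) in auto)
  qed
qed

lemma S2c_L2:
  assumes "Y \<in> S2c M T F" "t \<in> {0..T}"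
  shows "Y t \<in> L2 M"
proof (rule L2_bound[OF S2c_grid_max(1)[OF assms(1)] S2c_measurable[OF assms]])
  show "AE \<omega> in M. \<bar>Y t \<omega>\<bar> \<le> \<bar>grid_max T Y \<omega>\<bar>"
    using S2c_grid_max(2)[OF assms(1)] by eventually_elim (use assms(2) in \<open>auto simp: grid_max_nonneg\<close>)
qed

text \<open>Progressive measurability is joint measurability up to \<open>T\<close>; composing with the time truncated
  to the horizon gives a measurable variable that agrees with the stopped process almost surely.\<close>

lemma S2c_at_random_time:
  assumes Y: "Y \<in> S2c M T F" and \<tau>: "\<tau> \<in> borel_measurable M" "AE \<omega> in M. 0 \<le> \<tau> \<omega> \<and> \<tau> \<omega> \<le> T"
  shows "(\<lambda>\<omega>. Y (\<tau> \<omega>) \<omega>) \<in> borel_measurable M" "AE \<omega> in M. \<bar>Y (\<tau> \<omega>) \<omega>\<bar> \<le> grid_max T Y \<omega>"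
    "(\<lambda>\<omega>. Y (\<tau> \<omega>) \<omega>) \<in> L2 M"
proof -
  let ?\<rho> = "\<lambda>\<omega>. max 0 (min (\<tau> \<omega>) T)"
  have "(\<lambda>(s, \<omega>). Y s \<omega>) \<in> borel_measurable (restrict_space borel {0..T} \<Otimes>\<^sub>M F T)"
    using Y T_pos by (auto simp: S2c_def progressively_measurable_def)
  moreover have "(\<lambda>\<omega>. (?\<rho> \<omega>, \<omega>)) \<in> M \<rightarrow>\<^sub>M restrict_space borel {0..T} \<Otimes>\<^sub>M F T"
  proof (rule measurable_Pair)
    show "?\<rho> \<in> M \<rightarrow>\<^sub>M restrict_space borel {0..T}"
      using T_pos \<tau>(1) by (intro measurable_restrict_space2) auto
    show "(\<lambda>\<omega>. \<omega>) \<in> M \<rightarrow>\<^sub>M F T"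
      using sub[of T] by (auto simp: measurable_def subalgebra_def dest: sets.sets_into_space intro: sets.Int)
  qed
  ultimately have "(\<lambda>\<omega>. Y (?\<rho> \<omega>) \<omega>) \<in> borel_measurable M"
    using measurable_compose by fastforce
  then show m: "(\<lambda>\<omega>. Y (\<tau> \<omega>) \<omega>) \<in> borel_measurable M"
  proof (rule measurable_AE_eq)
    show "AE \<omega> in M. Y (?\<rho> \<omega>) \<omega> = Y (\<tau> \<omega>) \<omega>"
      using \<tau>(2) by eventually_elim simp
  qed simp
  show b: "AE \<omega> in M. \<bar>Y (\<tau> \<omega>) \<omega>\<bar> \<le> grid_max T Y \<omega>"
    using \<tau>(2) S2c_grid_max(2)[OF Y] by eventually_elim auto
  show "(\<lambda>\<omega>. Y (\<tau> \<omega>) \<omega>) \<in> L2 M"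
    by (rule L2_bound[OF S2c_grid_max(1)[OF Y] m]) (use b in \<open>auto simp: grid_max_nonneg\<close>)
qed

lemma stopping_times_measurable:
  assumes "\<tau> \<in> stopping_times M T F t"
  shows "\<tau> \<in> borel_measurable M"
proof -
  have "{\<omega> \<in> space M. \<tau> \<omega> \<le> c} \<in> sets M" for c
    using stopping_timeD[of F \<tau> c] assms F_space[of c]
    by (intro F_sets[of _ c]) (simp add: stopping_times_def pred_def)
  then show ?thesis by (simp add: borel_measurable_iff_le)
qed

lemma stopping_times_bounds:
  assumes "\<tau> \<in> stopping_times M T F t" "t \<in> {0..T}"
  shows "AE \<omega> in M. 0 \<le> \<tau> \<omega> \<and> \<tau> \<omega> \<le> T"
proof -
  have "AE \<omega> in M. t \<le> \<tau> \<omega> \<and> \<tau> \<omega> \<le> T" using assms(1) by (simp add: stopping_times_def)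
  then show ?thesis by eventually_elim (use assms(2) in auto)
qed

lemma const_stopping_times: "t \<le> s \<Longrightarrow> s \<le> T \<Longrightarrow> (\<lambda>_. s) \<in> stopping_times M T F t"
  by (simp add: stopping_times_def stopping_time_const)

lemmas S2c_stopped = S2c_at_random_time[OF _ stopping_times_measurable stopping_times_bounds]

text \<open>The cell where \<open>\<tau>\<close> rounds up to the grid point \<open>q\<close> is observable at time \<open>q\<close>. If \<open>q < t\<close>, the
  event \<open>A\<close> need not be known yet at \<open>q\<close>, but then the cell is null and belongs to every member of
  the filtration.\<close>

lemma dyadic_cell_measurable:
  assumes \<tau>: "\<tau> \<in> stopping_times M T F t" and A: "A \<in> sets (F t)"
  shows "A \<inter> {\<omega> \<in> space M. \<lceil>2 ^ m * \<tau> \<omega> / T\<rceil> = int k} \<in> sets (F (T * real k / 2 ^ m))"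
    (is "A \<inter> ?C \<in> sets (F ?q)")
proof -
  have le: "{\<omega> \<in> space M. \<tau> \<omega> \<le> c} \<in> sets (F c)" for c
    using stopping_timeD[of F \<tau> c] \<tau> F_space[of c] by (simp add: stopping_times_def pred_def)
  let ?p = "T * (real k - 1) / 2 ^ m"
  have "?C = {\<omega> \<in> space M. \<tau> \<omega> \<le> ?q} - {\<omega> \<in> space M. \<tau> \<omega> \<le> ?p}"
    using T_pos by (auto simp: ceiling_eq_iff field_simps)
  moreover have "?p \<le> ?q" using T_pos by (simp add: divide_right_mono)
  ultimately have C: "?C \<in> sets (F ?q)"
    using le[of ?q] le[of ?p] F_mono[of ?p ?q] by auto
  show ?thesis
  proof (cases "t \<le> ?q")
    case True
    then show ?thesis using A C F_mono[OF True] by auto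
  next
    case False
    have "AE \<omega> in M. t \<le> \<tau> \<omega> \<and> \<tau> \<omega> \<le> T" using \<tau> by (simp add: stopping_times_def)
    then have "AE \<omega> in M. \<omega> \<notin> A \<inter> ?C"
    proof eventually_elim
      case (elim \<omega>)
      have "\<tau> \<omega> \<le> ?q" if "\<lceil>2 ^ m * \<tau> \<omega> / T\<rceil> = int k"
        using that T_pos by (simp add: ceiling_eq_iff field_simps)
      with elim False show ?case by auto
    qed
    then have "A \<inter> ?C \<in> null_sets M"
      unfolding null_sets_iff_AE by auto
    then show ?thesis using null_F by auto
  qed
qed

end

section \<open>Optional stopping by dyadic discretisation\<close>

lemma sum_single_index:
  fixes a :: "nat \<Rightarrow> real"
  shows "(\<Sum>k<K. if c = int k then a k else 0) = (if 0 \<le> c \<and> c < int K then a (nat c) else 0)"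
proof (cases "0 \<le> c")
  case True
  then have "(c = int k) = (k = nat c)" for k by auto
  then show ?thesis using True by (simp add: nat_less_iff)
next
  case False
  then have "c \<noteq> int k" for k by auto
  with False show ?thesis by simp
qed

lemma lipschitz_continuous_measurable:
  fixes g :: "real \<Rightarrow> real"
  assumes "\<And>x y. \<bar>g x - g y\<bar> \<le> \<gamma> * \<bar>x - y\<bar>"
  shows "continuous_on UNIV g" "g \<in> borel_measurable borel"
proof -
  have "0 \<le> \<gamma>" using order_trans[OF abs_ge_zero assms[of 1 0]] by simp
  then show "continuous_on UNIV g"
    using assms by (intro lipschitz_on_continuous_on[of \<gamma>] lipschitz_onI) (auto simp: dist_real_def)
  then show "g \<in> borel_measurable borel" by (rule borel_measurable_continuous_onI)
qed

lemma L2_lipschitz: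
  fixes g :: "real \<Rightarrow> real"
  assumes "prob_space M" "\<And>x y. \<bar>g x - g y\<bar> \<le> \<gamma> * \<bar>x - y\<bar>" "X \<in> L2 M"
  shows "(\<lambda>\<omega>. g (X \<omega>)) \<in> L2 M"
proof -
  interpret prob_space M by fact
  have "(\<lambda>\<omega>. \<bar>g 0\<bar> + \<gamma> * \<bar>X \<omega>\<bar>) \<in> L2 M"
    by (intro L2_add L2_const L2_cmult L2_abs assms)
  then show ?thesis
  proof (rule L2_bound)
    show "(\<lambda>\<omega>. g (X \<omega>)) \<in> borel_measurable M"
      by (rule measurable_compose[OF L2_measurable[OF assms(3)] lipschitz_continuous_measurable(2)[OF assms(2)]])
    have "\<bar>g x\<bar> \<le> \<bar>\<bar>g 0\<bar> + \<gamma> * \<bar>x\<bar>\<bar>" for x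
      using assms(2)[of x 0] by simp
    then show "AE \<omega> in M. \<bar>g (X \<omega>)\<bar> \<le> \<bar>\<bar>g 0\<bar> + \<gamma> * \<bar>X \<omega>\<bar>\<bar>" by simp
  qed
qed

context complete_filtered_space
begin

text \<open>This is optional stopping for the martingale \<open>N\<close> at \<open>\<tau>\<close>, without evaluating \<open>N\<close> at a random
  time: \<open>N\<close> is only given on the grid and has no path regularity, whereas the payoff \<open>g (Y t)\<close> is
  continuous in \<open>t\<close>. So \<open>\<tau>\<close> is rounded up to the grid, on each cell \<open>\<xi>\<close> may be replaced by \<open>N\<close> and
  the payoff is at most \<open>N + R\<close>; then the mesh tends to zero.\<close>

lemma optional_stopping_le:
  fixes g :: "real \<Rightarrow> real"
  assumes Y: "Y \<in> S2c M T F" and \<xi>: "integrable M \<xi>"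
    and N: "\<And>q. q \<in> dyadic_grid T \<Longrightarrow> integrable M (N q)"
    and mart: "\<And>q A. q \<in> dyadic_grid T \<Longrightarrow> A \<in> sets (F q) \<Longrightarrow>
        (\<integral>\<omega>. indicator A \<omega> * N q \<omega> \<partial>M) = (\<integral>\<omega>. indicator A \<omega> * \<xi> \<omega> \<partial>M)"
    and g: "\<And>x y. \<bar>g x - g y\<bar> \<le> \<gamma> * \<bar>x - y\<bar>"
    and R: "integrable M R" "AE \<omega> in M. 0 \<le> R \<omega>"
    and le: "\<And>q. q \<in> dyadic_grid T \<Longrightarrow> AE \<omega> in M. g (Y q \<omega>) \<le> N q \<omega> + R \<omega>"
    and t: "t \<in> {0..T}" and \<tau>: "\<tau> \<in> stopping_times M T F t" and A: "A \<in> sets (F t)"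
  shows "(\<integral>\<omega>. indicator A \<omega> * (indicator {\<omega>. \<tau> \<omega> < T} \<omega> * (g (Y (\<tau> \<omega>) \<omega>) - \<xi> \<omega>)) \<partial>M)
    \<le> (\<integral>\<omega>. indicator A \<omega> * R \<omega> \<partial>M)"
proof -
  define q where "q m k = T * real k / 2 ^ m" for m k :: nat
  define C where "C m k = A \<inter> {\<omega> \<in> space M. \<lceil>2 ^ m * \<tau> \<omega> / T\<rceil> = int k}" for m k :: nat
  \<comment> \<open>The index stops short of \<open>2 ^ m\<close>: a time that rounds up to \<open>T\<close> collects \<open>\<xi>\<close> and contributes
    nothing.\<close>
  define f where "f m \<omega> = (\<Sum>k<2 ^ m. indicator (C m k) \<omega> * (g (Y (q m k) \<omega>) - \<xi> \<omega>))" for m \<omega>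
  have q: "q m k \<in> dyadic_grid T" if "k < 2 ^ m" for m k
    using that unfolding q_def by (intro dyadic_gridI) simp
  have CF: "C m k \<in> sets (F (q m k))" for m k
    unfolding C_def q_def by (rule dyadic_cell_measurable[OF \<tau> A])
  then have CM: "C m k \<in> sets M" for m k by (rule F_sets)
  have gY: "integrable M (\<lambda>\<omega>. g (Y p \<omega>))" if "p \<in> dyadic_grid T" for p
    by (rule L2_integrable[OF L2_lipschitz[OF prob_space_axioms g S2c_L2[OF Y grid_le_T[OF that]]]])
  have int: "integrable M (\<lambda>\<omega>. indicator (C m k) \<omega> * (g (Y (q m k) \<omega>) - \<xi> \<omega>))" if "k < 2 ^ m" for m k
    by (intro integrable_indicator_times Bochner_Integration.integrable_diff gY q that \<xi> CM)
  \<comment> \<open>The cell is observable at its grid point, so the martingale property replaces \<open>\<xi>\<close> by \<open>N\<close>.\<close>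
  have cell: "(\<integral>\<omega>. indicator (C m k) \<omega> * (g (Y (q m k) \<omega>) - \<xi> \<omega>) \<partial>M) \<le> (\<integral>\<omega>. indicator (C m k) \<omega> * R \<omega> \<partial>M)"
    if k: "k < 2 ^ m" for m k
  proof -
    note qk = q[OF k]
    have "(\<integral>\<omega>. indicator (C m k) \<omega> * (g (Y (q m k) \<omega>) - \<xi> \<omega>) \<partial>M)
        = (\<integral>\<omega>. indicator (C m k) \<omega> * (g (Y (q m k) \<omega>) - N (q m k) \<omega>) \<partial>M)"
      using mart[OF qk CF] integrable_indicator_times[OF gY[OF qk] CM[of m k]]
        integrable_indicator_times[OF \<xi> CM[of m k]] integrable_indicator_times[OF N[OF qk] CM[of m k]]
      by (simp add: right_diff_distrib)
    also have "\<dots> \<le> (\<integral>\<omega>. indicator (C m k) \<omega> * R \<omega> \<partial>M)"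
    proof (rule integral_mono_AE)
      show "AE \<omega> in M. indicator (C m k) \<omega> * (g (Y (q m k) \<omega>) - N (q m k) \<omega>) \<le> indicator (C m k) \<omega> * R \<omega>"
        using le[OF qk] by eventually_elim (auto simp: indicator_def)
    qed (intro integrable_indicator_times Bochner_Integration.integrable_diff gY qk N R CM)+
    finally show ?thesis .
  qed
  have sumC: "(\<Sum>k<2 ^ m. indicator (C m k) \<omega> * r k) = indicator A \<omega> *
      (if 0 \<le> \<lceil>2 ^ m * \<tau> \<omega> / T\<rceil> \<and> \<lceil>2 ^ m * \<tau> \<omega> / T\<rceil> < 2 ^ m then r (nat \<lceil>2 ^ m * \<tau> \<omega> / T\<rceil>) else 0)"
    if "\<omega> \<in> space M" for m \<omega> and r :: "nat \<Rightarrow> real"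
  proof -
    have "(\<Sum>k<2 ^ m. indicator (C m k) \<omega> * r k) =
        (\<Sum>k<2 ^ m. if \<lceil>2 ^ m * \<tau> \<omega> / T\<rceil> = int k then indicator A \<omega> * r k else 0)"
      using that by (intro sum.cong) (auto simp: C_def indicator_def)
    then show ?thesis by (simp add: sum_single_index)
  qed
  have fm: "(\<integral>\<omega>. f m \<omega> \<partial>M) \<le> (\<integral>\<omega>. indicator A \<omega> * R \<omega> \<partial>M)" for m
  proof -
    have iR: "integrable M (\<lambda>\<omega>. indicator (C m k) \<omega> * R \<omega>)" for k
      by (rule integrable_indicator_times[OF R(1) CM])
    have "(\<integral>\<omega>. f m \<omega> \<partial>M) = (\<Sum>k<2 ^ m. \<integral>\<omega>. indicator (C m k) \<omega> * (g (Y (q m k) \<omega>) - \<xi> \<omega>) \<partial>M)"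
      unfolding f_def using int by (intro Bochner_Integration.integral_sum) simp
    also have "\<dots> \<le> (\<Sum>k<2 ^ m. \<integral>\<omega>. indicator (C m k) \<omega> * R \<omega> \<partial>M)"
      by (intro sum_mono cell) simp
    also have "\<dots> = (\<integral>\<omega>. (\<Sum>k<2 ^ m. indicator (C m k) \<omega> * R \<omega>) \<partial>M)"
      using iR by (intro Bochner_Integration.integral_sum[symmetric]) simp
    also have "\<dots> \<le> (\<integral>\<omega>. indicator A \<omega> * R \<omega> \<partial>M)"
    proof (rule integral_mono_AE)
      show "integrable M (\<lambda>\<omega>. \<Sum>k<2 ^ m. indicator (C m k) \<omega> * R \<omega>)"
        using iR by (intro Bochner_Integration.integrable_sum) simp
      show "integrable M (\<lambda>\<omega>. indicator A \<omega> * R \<omega>)"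
        by (rule integrable_indicator_times[OF R(1) F_sets[OF A]])
      show "AE \<omega> in M. (\<Sum>k<2 ^ m. indicator (C m k) \<omega> * R \<omega>) \<le> indicator A \<omega> * R \<omega>"
        using R(2) AE_space
      proof eventually_elim
        case (elim \<omega>)
        show ?case unfolding sumC[OF elim(2)] using elim(1) by (simp add: indicator_def)
      qed
    qed
    finally show ?thesis .
  qed
  have \<tau>m: "\<tau> \<in> borel_measurable M" by (rule stopping_times_measurable[OF \<tau>])
  have lim: "(\<lambda>m. \<integral>\<omega>. f m \<omega> \<partial>M) \<longlonglongrightarrow>
      (\<integral>\<omega>. indicator A \<omega> * (indicator {\<omega>. \<tau> \<omega> < T} \<omega> * (g (Y (\<tau> \<omega>) \<omega>) - \<xi> \<omega>)) \<partial>M)"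
  proof (rule integral_dominated_convergence)
    let ?w = "\<lambda>\<omega>. (\<bar>g 0\<bar> + \<gamma> * grid_max T Y \<omega>) + \<bar>\<xi> \<omega>\<bar>"
    show "integrable M ?w"
      using L2_integrable[OF S2c_grid_max(1)[OF Y]] \<xi> by simp
    have "{\<omega>. \<tau> \<omega> < T} \<inter> space M \<in> sets M"
      using \<tau>m by (simp add: borel_measurable_iff_less Int_def conj_commute)
    then have "(indicator {\<omega>. \<tau> \<omega> < T} :: 'a \<Rightarrow> real) \<in> borel_measurable M"
      by (simp add: borel_measurable_indicator_iff)
    moreover have "(indicator A :: 'a \<Rightarrow> real) \<in> borel_measurable M" using F_sets[OF A] by simp
    moreover have "(\<lambda>\<omega>. g (Y (\<tau> \<omega>) \<omega>)) \<in> borel_measurable M"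
      by (rule measurable_compose[OF S2c_stopped(1)[OF Y \<tau> \<tau> t] lipschitz_continuous_measurable(2)[OF g]])
    ultimately show "(\<lambda>\<omega>. indicator A \<omega> * (indicator {\<omega>. \<tau> \<omega> < T} \<omega> * (g (Y (\<tau> \<omega>) \<omega>) - \<xi> \<omega>))) \<in> borel_measurable M"
      using \<xi> by (intro borel_measurable_times borel_measurable_diff) auto
    show "f m \<in> borel_measurable M" for m
      unfolding f_def using int by (intro borel_measurable_sum) (auto intro: borel_measurable_integrable)
    show "AE \<omega> in M. (\<lambda>m. f m \<omega>) \<longlonglongrightarrow> indicator A \<omega> * (indicator {\<omega>. \<tau> \<omega> < T} \<omega> * (g (Y (\<tau> \<omega>) \<omega>) - \<xi> \<omega>))"
      using stopping_times_bounds[OF \<tau> t] AE_space S2c_continuous[OF Y]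
    proof eventually_elim
      case (elim \<omega>)
      let ?u = "\<lambda>m. dyadic_up T m (\<tau> \<omega>)"
      have f_eq: "f m \<omega> = indicator A \<omega> * (if ?u m < T then g (Y (?u m) \<omega>) - \<xi> \<omega> else 0)" for m
      proof -
        obtain k where k: "k \<le> 2 ^ m" "\<lceil>2 ^ m * \<tau> \<omega> / T\<rceil> = int k" "?u m = T * real k / 2 ^ m"
          using dyadic_up_index[OF T_pos] elim(1) by blast
        have "?u m < T \<longleftrightarrow> real k < 2 ^ m"
          unfolding k(3) using T_pos by (simp add: divide_less_eq)
        also have "\<dots> \<longleftrightarrow> k < 2 ^ m" by (metis of_nat_less_iff of_nat_numeral of_nat_power)
        finally have "?u m < T \<longleftrightarrow> int k < 2 ^ m" by (metis of_nat_less_iff of_nat_numeral of_nat_power)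
        then show ?thesis
          unfolding f_def sumC[OF elim(2)] by (simp add: k(2) q_def k(3)[symmetric])
      qed
      show ?case
      proof (cases "\<tau> \<omega> < T")
        case True
        have up: "?u \<longlonglongrightarrow> \<tau> \<omega>" by (rule dyadic_up_tendsto[OF T_pos])
        have "(\<lambda>m. Y (?u m) \<omega>) \<longlonglongrightarrow> Y (\<tau> \<omega>) \<omega>"
          using elim(1) dyadic_up_grid[OF T_pos] grid_le_T
          by (intro continuous_on_tendsto_compose[OF elim(3) up] always_eventually allI) auto
        then have "(\<lambda>m. g (Y (?u m) \<omega>)) \<longlonglongrightarrow> g (Y (\<tau> \<omega>) \<omega>)"
          using lipschitz_continuous_measurable(1)[OF g]
          by (intro continuous_on_tendsto_compose[of UNIV g]) auto
        then have "(\<lambda>m. indicator A \<omega> * (g (Y (?u m) \<omega>) - \<xi> \<omega>)) \<longlonglongrightarrow> indicator A \<omega> * (g (Y (\<tau> \<omega>) \<omega>) - \<xi> \<omega>)"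
          by (intro tendsto_intros)
        moreover have "\<forall>\<^sub>F m in sequentially. indicator A \<omega> * (g (Y (?u m) \<omega>) - \<xi> \<omega>) = f m \<omega>"
          using order_tendstoD(2)[OF up True] by eventually_elim (simp add: f_eq)
        ultimately show ?thesis using True by (simp add: Lim_transform_eventually)
      next
        case False
        \<comment> \<open>If \<open>\<tau> = T\<close>, every rounded time is \<open>T\<close> as well.\<close>
        then have "\<not> ?u m < T" for m using dyadic_up_bounds(1)[OF T_pos, of "\<tau> \<omega>" m] by linarith
        then show ?thesis using False by (simp add: f_eq)
      qed
    qed
    show "AE \<omega> in M. norm (f m \<omega>) \<le> ?w \<omega>" for m
      using AE_space S2c_grid_max(2)[OF Y]
    proof eventually_elim
      case (elim \<omega>)
      have \<gamma>: "0 \<le> \<gamma>" using order_trans[OF abs_ge_zero g[of 1 0]] by simp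
      have w: "0 \<le> ?w \<omega>" using \<gamma> grid_max_nonneg[of T Y \<omega>] by simp
      have "\<bar>g (Y p \<omega>) - \<xi> \<omega>\<bar> \<le> ?w \<omega>" if "p \<in> dyadic_grid T" for p
      proof -
        have "\<gamma> * \<bar>Y p \<omega>\<bar> \<le> \<gamma> * grid_max T Y \<omega>"
          using elim(2) grid_le_T[OF that] \<gamma> by (intro mult_left_mono) auto
        then show ?thesis using g[of "Y p \<omega>" 0] by simp
      qed
      then have "\<bar>g (Y (q m (nat c)) \<omega>) - \<xi> \<omega>\<bar> \<le> ?w \<omega>" if "0 \<le> c" "c < 2 ^ m" for c :: int
        using q[of "nat c" m] that by (simp add: nat_less_iff)
      then show ?case
        unfolding f_def sumC[OF elim(1)] using w by (simp add: indicator_def)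
    qed
  qed
  show ?thesis by (rule LIMSEQ_le_const2[OF lim]) (use fm in auto)
qed

end

section \<open>Value processes close to the martingale of the terminal value\<close>

text \<open>The sub-fixpoints of a contraction of the line form the half line above its fixed point. A bound
  of this form passes to conditional expectations.\<close>

lemma lipschitz_sub_fixpoints:
  fixes g :: "real \<Rightarrow> real"
  assumes g: "\<And>x y. \<bar>g x - g y\<bar> \<le> \<gamma> * \<bar>x - y\<bar>" and \<gamma>: "\<gamma> < 1"
  obtains L where "\<And>y. g y \<le> y \<longleftrightarrow> L \<le> y"
proof -
  have "0 \<le> \<gamma>" using order_trans[OF abs_ge_zero g[of 1 0]] by simp
  then obtain L where L: "g L = L"
    using banach_fix_type[of \<gamma> g] g \<gamma> by (auto simp: dist_real_def)
  have "g y \<le> y \<longleftrightarrow> L \<le> y" for y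
  proof (cases "L \<le> y")
    case True
    have "\<gamma> * \<bar>y - L\<bar> \<le> 1 * \<bar>y - L\<bar>" using \<gamma> by (intro mult_right_mono) auto
    then show ?thesis using True g[of y L] L by auto
  next
    case False
    then have "\<gamma> * \<bar>y - L\<bar> < 1 * \<bar>y - L\<bar>" using \<gamma> by (intro mult_strict_right_mono) auto
    then have "\<bar>g y - L\<bar> < \<bar>y - L\<bar>" using g[of y L] unfolding L mult_1 by (rule le_less_trans[rotated])
    then show ?thesis using False by linarith
  qed
  then show ?thesis using that by blast
qed

text \<open>The number 1/16 is what makes Doob's constant 4 leave the factor 1/4, hence a contraction, in
  the estimate of a value process below.\<close>

locale small_lipschitz =
  fixes h :: "real \<Rightarrow> real \<Rightarrow> real" and \<gamma>\<^sub>1 \<gamma>\<^sub>2 :: real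
  assumes h: "\<And>y\<^sub>1 y\<^sub>2 z\<^sub>1 z\<^sub>2. \<bar>h y\<^sub>1 z\<^sub>1 - h y\<^sub>2 z\<^sub>2\<bar> \<le> \<gamma>\<^sub>1 * \<bar>y\<^sub>1 - y\<^sub>2\<bar> + \<gamma>\<^sub>2 * \<bar>z\<^sub>1 - z\<^sub>2\<bar>"
    and \<gamma>: "0 < \<gamma>\<^sub>1" "0 < \<gamma>\<^sub>2" "\<gamma>\<^sub>1\<^sup>2 + \<gamma>\<^sub>2\<^sup>2 < 1 / 16"
begin

lemma h_fst: "\<bar>h x z - h y z\<bar> \<le> \<gamma>\<^sub>1 * \<bar>x - y\<bar>"
  using h[of x z y z] by simp

lemma \<gamma>\<^sub>1_less_1: "\<gamma>\<^sub>1 < 1"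
proof (rule ccontr)
  assume "\<not> \<gamma>\<^sub>1 < 1"
  then have "1 \<le> \<gamma>\<^sub>1\<^sup>2" by (simp add: one_le_power)
  then show False using \<gamma>(3) zero_le_power2[of \<gamma>\<^sub>2] by linarith
qed

lemma h_continuous: "continuous_on UNIV (\<lambda>p. h (fst p) (snd p))"
proof (rule lipschitz_on_continuous_on)
  show "(\<gamma>\<^sub>1 + \<gamma>\<^sub>2)-lipschitz_on UNIV (\<lambda>p. h (fst p) (snd p))"
  proof (rule lipschitz_onI)
    fix p q :: "real \<times> real"
    have "dist (h (fst p) (snd p)) (h (fst q) (snd q)) \<le> \<gamma>\<^sub>1 * dist (fst p) (fst q) + \<gamma>\<^sub>2 * dist (snd p) (snd q)"
      using h by (simp add: dist_real_def)
    also have "\<dots> \<le> \<gamma>\<^sub>1 * dist p q + \<gamma>\<^sub>2 * dist p q"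
      using \<gamma> by (intro add_mono mult_left_mono dist_fst_le dist_snd_le) auto
    finally show "dist (h (fst p) (snd p)) (h (fst q) (snd q)) \<le> (\<gamma>\<^sub>1 + \<gamma>\<^sub>2) * dist p q"
      by (simp add: distrib_right)
  qed (use \<gamma> in simp)
qed

lemma h_measurable:
  assumes "X \<in> borel_measurable M" "Z \<in> borel_measurable M"
  shows "(\<lambda>\<omega>. h (X \<omega>) (Z \<omega>)) \<in> borel_measurable M"
  by (rule borel_measurable_continuous_Pair[OF assms h_continuous])

lemma h_tendsto:
  assumes "(x \<longlongrightarrow> x\<^sub>0) A" "(z \<longlongrightarrow> z\<^sub>0) A"
  shows "((\<lambda>n. h (x n) (z n)) \<longlongrightarrow> h x\<^sub>0 z\<^sub>0) A"
  using continuous_on_tendsto_compose[OF h_continuous tendsto_Pair[OF assms]] by simp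

lemma h_L2:
  assumes "prob_space M" "X \<in> L2 M" "Z \<in> L2 M"
  shows "(\<lambda>\<omega>. h (X \<omega>) (Z \<omega>)) \<in> L2 M"
proof -
  interpret prob_space M by fact
  have "(\<lambda>\<omega>. \<bar>h 0 0\<bar> + (\<gamma>\<^sub>1 * \<bar>X \<omega>\<bar> + \<gamma>\<^sub>2 * \<bar>Z \<omega>\<bar>)) \<in> L2 M"
    by (intro L2_add L2_const L2_cmult L2_abs assms)
  then show ?thesis
  proof (rule L2_bound)
    show "(\<lambda>\<omega>. h (X \<omega>) (Z \<omega>)) \<in> borel_measurable M"
      by (intro h_measurable L2_measurable assms)
    have "\<bar>h x z\<bar> \<le> \<bar>\<bar>h 0 0\<bar> + (\<gamma>\<^sub>1 * \<bar>x\<bar> + \<gamma>\<^sub>2 * \<bar>z\<bar>)\<bar>" for x z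
      using h[of x z 0 0] by simp
    then show "AE \<omega> in M. \<bar>h (X \<omega>) (Z \<omega>)\<bar> \<le> \<bar>\<bar>h 0 0\<bar> + (\<gamma>\<^sub>1 * \<bar>X \<omega>\<bar> + \<gamma>\<^sub>2 * \<bar>Z \<omega>\<bar>)\<bar>"
      by simp
  qed
qed

end

lemma payoff_eq:
  "payoff T \<tau> H \<xi> \<omega> = (if \<tau> \<omega> < T then H \<omega> else if \<tau> \<omega> = T then \<xi> \<omega> else 0)"
  by (simp add: payoff_def indicator_def)

lemma payoff_L2:
  assumes "\<tau> \<in> borel_measurable M" "H \<in> L2 M" "\<xi> \<in> L2 M"
  shows "payoff T \<tau> H \<xi> \<in> L2 M"
proof (rule L2_bound[OF L2_add[OF L2_abs[OF assms(2)] L2_abs[OF assms(3)]]])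
  have [measurable]: "\<tau> \<in> borel_measurable M" "H \<in> borel_measurable M" "\<xi> \<in> borel_measurable M"
    using assms by (auto simp: L2_iff)
  show "payoff T \<tau> H \<xi> \<in> borel_measurable M"
    unfolding payoff_eq by measurable
  show "AE \<omega> in M. \<bar>payoff T \<tau> H \<xi> \<omega>\<bar> \<le> \<bar>\<bar>H \<omega>\<bar> + \<bar>\<xi> \<omega>\<bar>\<bar>"
    by (simp add: payoff_eq)
qed

lemma is_ess_sup_le:
  assumes "is_ess_sup M \<X> y" "z \<in> borel_measurable M" "\<And>X. X \<in> \<X> \<Longrightarrow> AE \<omega> in M. X \<omega> \<le> z \<omega>"
  shows "AE \<omega> in M. y \<omega> \<le> z \<omega>"
  using assms by (simp add: is_ess_sup_def)

text \<open>The distance of \<open>Y\<close> from the value of never stopping early.\<close>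

definition martingale_gap ::
    "'a measure \<Rightarrow> (real \<Rightarrow> 'a measure) \<Rightarrow> real \<Rightarrow> (real \<Rightarrow> 'a \<Rightarrow> real) \<Rightarrow> ('a \<Rightarrow> real) \<Rightarrow> 'a \<Rightarrow> real" where
  "martingale_gap M F T Y \<xi> = grid_max T (\<lambda>q \<omega>. Y q \<omega> - real_cond_exp M (F q) \<xi> \<omega>)"

context complete_filtered_space
begin

lemma cond_exp_L2: "\<xi> \<in> L2 M \<Longrightarrow> real_cond_exp M (F q) \<xi> \<in> L2 M"
  by (rule sigma_finite_subalgebra.real_cond_exp_L2[OF sigma_finite_subalgebra_F]) (auto intro: L2_integrable)

lemma cond_exp_indicator:
  assumes "\<xi> \<in> L2 M" "A \<in> sets (F q)"
  shows "(\<integral>\<omega>. indicator A \<omega> * real_cond_exp M (F q) \<xi> \<omega> \<partial>M) = (\<integral>\<omega>. indicator A \<omega> * \<xi> \<omega> \<partial>M)"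
  by (rule sigma_finite_subalgebra.real_cond_exp_indicator[OF sigma_finite_subalgebra_F L2_integrable[OF assms(1)] assms(2)])

lemma Doob_L2_cond_exp:
  assumes "\<xi> \<in> L2 M"
  shows "(\<integral>\<^sup>+\<omega>. (SUP q\<in>dyadic_grid T. ennreal ((real_cond_exp M (F q) \<xi> \<omega>)\<^sup>2)) \<partial>M)
    \<le> ennreal (4 * (\<integral>\<omega>. (\<xi> \<omega>)\<^sup>2 \<partial>M))"
  by (rule Doob_L2_grid[OF T_pos sub F_mono _ cond_exp_L2 _ cond_exp_indicator])
    (use assms in auto)

lemma martingale_gap_L2:
  assumes Y: "Y \<in> S2c M T F" and \<xi>: "\<xi> \<in> L2 M"
  shows "martingale_gap M F T Y \<xi> \<in> L2 M"
    "AE \<omega> in M. \<forall>q\<in>dyadic_grid T. \<bar>Y q \<omega> - real_cond_exp M (F q) \<xi> \<omega>\<bar> \<le> martingale_gap M F T Y \<xi> \<omega>"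
proof -
  let ?N = "\<lambda>q. real_cond_exp M (F q) \<xi>"
  note Nmax = grid_max_L2[OF borel_measurable_cond_exp2 _ Doob_L2_cond_exp[OF \<xi>]]
  have B: "(\<lambda>\<omega>. grid_max T Y \<omega> + grid_max T ?N \<omega>) \<in> L2 M"
    using S2c_grid_max(1)[OF Y] Nmax(1) by (intro L2_add) auto
  have "AE \<omega> in M. \<bar>Y q \<omega> - ?N q \<omega>\<bar> \<le> grid_max T Y \<omega> + grid_max T ?N \<omega>" if q: "q \<in> dyadic_grid T" for q
  proof -
    have "AE \<omega> in M. \<forall>q\<in>dyadic_grid T. \<bar>?N q \<omega>\<bar> \<le> grid_max T ?N \<omega>"
      using Nmax(3) by simp
    with S2c_grid_max(2)[OF Y] show ?thesis
    proof eventually_elim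
      case (elim \<omega>)
      show ?case using bspec[OF elim(1) grid_le_T[OF q]] bspec[OF elim(2) q] by linarith
    qed
  qed
  from grid_max_dominated[OF _ B this] show
    "martingale_gap M F T Y \<xi> \<in> L2 M"
    "AE \<omega> in M. \<forall>q\<in>dyadic_grid T. \<bar>Y q \<omega> - ?N q \<omega>\<bar> \<le> martingale_gap M F T Y \<xi> \<omega>"
    using S2c_measurable[OF Y grid_le_T] unfolding martingale_gap_def
    by (auto intro!: borel_measurable_diff)
qed

lemma martingale_gap_nonneg: "0 \<le> martingale_gap M F T Y \<xi> \<omega>"
  by (simp add: martingale_gap_def grid_max_nonneg)

text \<open>Waiting until \<open>T\<close> is always allowed.\<close>

lemma value_ge_cond_exp:
  assumes ess: "is_ess_sup M {real_cond_exp M (F t) (payoff T \<tau> (H \<tau>) \<xi>) | \<tau>. \<tau> \<in> stopping_times M T F t} y"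
    and t: "t \<le> T"
  shows "AE \<omega> in M. real_cond_exp M (F t) \<xi> \<omega> \<le> y \<omega>"
proof -
  have "payoff T (\<lambda>_. T) (H (\<lambda>_. T)) \<xi> = \<xi>" by (auto simp: payoff_eq)
  then have "real_cond_exp M (F t) \<xi> \<in> {real_cond_exp M (F t) (payoff T \<tau> (H \<tau>) \<xi>) | \<tau>. \<tau> \<in> stopping_times M T F t}"
    using const_stopping_times[OF t order_refl] by force
  then show ?thesis using ess by (auto simp: is_ess_sup_def)
qed

text \<open>The estimate that serves both systems; \<open>Z \<tau>\<close> is the mean-field argument of the reward, and \<open>V\<close>
  bounds its distance from the terminal mean \<open>b\<close>. The obstacle condition \<open>h \<xi> b \<le> \<xi>\<close> is inherited
  by the martingale of \<open>\<xi>\<close>, so stopping early can beat waiting only through the gap \<open>D\<close> itself and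
  through \<open>V\<close>: at each grid time the distance is at most the conditional expectation of \<open>\<gamma>\<^sub>1 * D + \<gamma>\<^sub>2 * V\<close>. Doob's and the
  Cauchy-Schwarz inequality then give \<open>E[D\<^sup>2] \<le> 4 * (\<gamma>\<^sub>1\<^sup>2 + \<gamma>\<^sub>2\<^sup>2) * (E[D\<^sup>2] + E[V\<^sup>2])\<close>, and the first term
  on the right is absorbed.\<close>

lemma martingale_gap_le:
  fixes Z :: "('a \<Rightarrow> real) \<Rightarrow> 'a \<Rightarrow> real"
  assumes h: "small_lipschitz h \<gamma>\<^sub>1 \<gamma>\<^sub>2"
    and Y: "Y \<in> S2c M T F" and \<xi>: "\<xi> \<in> L2 M" and V: "V \<in> L2 M"
    and obstacle: "AE \<omega> in M. h (\<xi> \<omega>) b \<le> \<xi> \<omega>"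
    and Z: "\<And>t \<tau>. t \<in> {0..T} \<Longrightarrow> \<tau> \<in> stopping_times M T F t \<Longrightarrow> Z \<tau> \<in> L2 M"
      "\<And>t \<tau>. t \<in> {0..T} \<Longrightarrow> \<tau> \<in> stopping_times M T F t \<Longrightarrow> AE \<omega> in M. \<bar>Z \<tau> \<omega> - b\<bar> \<le> V \<omega>"
    and ess: "\<And>t. t \<in> {0..T} \<Longrightarrow> is_ess_sup M
        {real_cond_exp M (F t) (payoff T \<tau> (\<lambda>\<omega>. h (Y (\<tau> \<omega>) \<omega>) (Z \<tau> \<omega>)) \<xi>) | \<tau>. \<tau> \<in> stopping_times M T F t} (Y t)"
  shows "(\<integral>\<omega>. (martingale_gap M F T Y \<xi> \<omega>)\<^sup>2 \<partial>M) \<le> 1 / 3 * (\<integral>\<omega>. (V \<omega>)\<^sup>2 \<partial>M)"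
proof -
  interpret small_lipschitz h \<gamma>\<^sub>1 \<gamma>\<^sub>2 by (rule h)
  let ?N = "\<lambda>q. real_cond_exp M (F q) \<xi>" and ?D = "martingale_gap M F T Y \<xi>"
  define U where "U \<omega> = \<gamma>\<^sub>1 * ?D \<omega> + \<gamma>\<^sub>2 * V \<omega>" for \<omega>
  have D: "?D \<in> L2 M" and gap: "AE \<omega> in M. \<forall>q\<in>dyadic_grid T. \<bar>Y q \<omega> - ?N q \<omega>\<bar> \<le> ?D \<omega>"
    by (rule martingale_gap_L2[OF Y \<xi>])+
  have UL: "U \<in> L2 M" unfolding U_def by (intro L2_add L2_cmult D V)
  obtain L where L: "h y b \<le> y \<longleftrightarrow> L \<le> y" for y
    using lipschitz_sub_fixpoints[of "\<lambda>y. h y b" \<gamma>\<^sub>1] h_fst \<gamma>\<^sub>1_less_1 by blast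
  have hN: "AE \<omega> in M. h (?N q \<omega>) b \<le> ?N q \<omega>" for q
    unfolding L using obstacle
    by (intro sigma_finite_subalgebra.real_cond_exp_ge_c[OF sigma_finite_subalgebra_F] L2_integrable[OF \<xi>]) (simp add: L)
  have hY: "AE \<omega> in M. h (Y q \<omega>) b \<le> ?N q \<omega> + \<gamma>\<^sub>1 * ?D \<omega>" if "q \<in> dyadic_grid T" for q
    using hN[of q] gap
  proof eventually_elim
    case (elim \<omega>)
    have "\<gamma>\<^sub>1 * \<bar>Y q \<omega> - ?N q \<omega>\<bar> \<le> \<gamma>\<^sub>1 * ?D \<omega>" using elim(2) that \<gamma> by (intro mult_left_mono) auto
    then show ?case using elim(1) h_fst[of "Y q \<omega>" b "?N q \<omega>"] by linarith
  qed
  have payoff_le: "AE \<omega> in M. real_cond_exp M (F t) (payoff T \<tau> (\<lambda>\<omega>. h (Y (\<tau> \<omega>) \<omega>) (Z \<tau> \<omega>)) \<xi>) \<omega>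
      \<le> real_cond_exp M (F t) (\<lambda>\<omega>. \<xi> \<omega> + U \<omega>) \<omega>" (is "AE \<omega> in M. real_cond_exp M (F t) ?P \<omega> \<le> _")
    if t: "t \<in> {0..T}" and \<tau>: "\<tau> \<in> stopping_times M T F t" for t \<tau>
  proof (rule sigma_finite_subalgebra.real_cond_exp_le_of_integral_le[OF sigma_finite_subalgebra_F])
    have YL: "(\<lambda>\<omega>. Y (\<tau> \<omega>) \<omega>) \<in> L2 M" by (rule S2c_stopped(3)[OF Y \<tau> \<tau> t])
    have P: "?P \<in> L2 M"
      by (intro payoff_L2 stopping_times_measurable[OF \<tau>] h_L2[OF prob_space_axioms YL] Z[OF t \<tau>] \<xi>)
    \<comment> \<open>The gain over waiting when the mean-field argument is frozen at \<open>b\<close>.\<close>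
    let ?G = "payoff T \<tau> (\<lambda>\<omega>. h (Y (\<tau> \<omega>) \<omega>) b - \<xi> \<omega>) (\<lambda>_. 0)"
    have G: "?G \<in> L2 M"
      by (intro payoff_L2 stopping_times_measurable[OF \<tau>] L2_diff h_L2[OF prob_space_axioms YL] L2_const \<xi>)
    show "integrable M ?P" "integrable M (\<lambda>\<omega>. \<xi> \<omega> + U \<omega>)"
      by (intro L2_integrable L2_add P \<xi> UL)+
    fix A assume A: "A \<in> sets (F t)"
    note ind = integrable_indicator_times[OF L2_integrable F_sets[OF A]]
    have PG: "AE \<omega> in M. ?P \<omega> \<le> \<xi> \<omega> + (?G \<omega> + \<gamma>\<^sub>2 * V \<omega>)"
      using stopping_times_bounds[OF \<tau> t] Z(2)[OF t \<tau>]
    proof eventually_elim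
      case (elim \<omega>)
      have "h (Y (\<tau> \<omega>) \<omega>) (Z \<tau> \<omega>) - h (Y (\<tau> \<omega>) \<omega>) b \<le> \<gamma>\<^sub>2 * \<bar>Z \<tau> \<omega> - b\<bar>"
        using h[of "Y (\<tau> \<omega>) \<omega>" "Z \<tau> \<omega>" "Y (\<tau> \<omega>) \<omega>" b] by simp
      moreover have "\<gamma>\<^sub>2 * \<bar>Z \<tau> \<omega> - b\<bar> \<le> \<gamma>\<^sub>2 * V \<omega>" using elim(2) \<gamma> by (intro mult_left_mono) auto
      moreover have "0 \<le> \<gamma>\<^sub>2 * V \<omega>" using elim(2) \<gamma> by (intro mult_nonneg_nonneg) auto
      ultimately show ?case using elim(1) by (simp add: payoff_eq)
    qed
    have "(\<integral>\<omega>. indicator A \<omega> * ?P \<omega> \<partial>M) \<le> (\<integral>\<omega>. indicator A \<omega> * (\<xi> \<omega> + (?G \<omega> + \<gamma>\<^sub>2 * V \<omega>)) \<partial>M)"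
    proof (rule integral_mono_AE)
      show "AE \<omega> in M. indicator A \<omega> * ?P \<omega> \<le> indicator A \<omega> * (\<xi> \<omega> + (?G \<omega> + \<gamma>\<^sub>2 * V \<omega>))"
        using PG by eventually_elim (auto simp: indicator_def)
    qed (intro ind L2_add L2_cmult P \<xi> G V)+
    also have "\<dots> = (\<integral>\<omega>. indicator A \<omega> * \<xi> \<omega> \<partial>M) + ((\<integral>\<omega>. indicator A \<omega> * ?G \<omega> \<partial>M) + (\<integral>\<omega>. indicator A \<omega> * (\<gamma>\<^sub>2 * V \<omega>) \<partial>M))"
      using ind[OF \<xi>] ind[OF G] ind[OF L2_cmult[OF V, of \<gamma>\<^sub>2]] by (simp add: distrib_left)
    also have "(\<integral>\<omega>. indicator A \<omega> * ?G \<omega> \<partial>M) \<le> (\<integral>\<omega>. indicator A \<omega> * (\<gamma>\<^sub>1 * ?D \<omega>) \<partial>M)"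
    proof -
      have "?G = (\<lambda>\<omega>. indicator {\<omega>. \<tau> \<omega> < T} \<omega> * (h (Y (\<tau> \<omega>) \<omega>) b - \<xi> \<omega>))"
        by (auto simp: payoff_eq indicator_def)
      moreover have "AE \<omega> in M. 0 \<le> \<gamma>\<^sub>1 * ?D \<omega>" using \<gamma> martingale_gap_nonneg by simp
      ultimately show ?thesis
        using optional_stopping_le[OF Y L2_integrable[OF \<xi>] L2_integrable[OF cond_exp_L2[OF \<xi>]]
            cond_exp_indicator[OF \<xi>] h_fst L2_integrable[OF L2_cmult[OF D]] _ hY t \<tau> A]
        by simp
    qed
    also have "(\<integral>\<omega>. indicator A \<omega> * \<xi> \<omega> \<partial>M) + ((\<integral>\<omega>. indicator A \<omega> * (\<gamma>\<^sub>1 * ?D \<omega>) \<partial>M) + (\<integral>\<omega>. indicator A \<omega> * (\<gamma>\<^sub>2 * V \<omega>) \<partial>M))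
        = (\<integral>\<omega>. indicator A \<omega> * (\<xi> \<omega> + U \<omega>) \<partial>M)"
      unfolding U_def using ind[OF \<xi>] ind[OF L2_cmult[OF D, of \<gamma>\<^sub>1]] ind[OF L2_cmult[OF V, of \<gamma>\<^sub>2]]
      by (simp add: distrib_left)
    finally show "(\<integral>\<omega>. indicator A \<omega> * ?P \<omega> \<partial>M) \<le> (\<integral>\<omega>. indicator A \<omega> * (\<xi> \<omega> + U \<omega>) \<partial>M)" by simp
  qed
  have step: "AE \<omega> in M. \<bar>Y q \<omega> - ?N q \<omega>\<bar> \<le> \<bar>real_cond_exp M (F q) U \<omega>\<bar>" if q: "q \<in> dyadic_grid T" for q
  proof -
    have "AE \<omega> in M. Y q \<omega> \<le> real_cond_exp M (F q) (\<lambda>\<omega>. \<xi> \<omega> + U \<omega>) \<omega>"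
      by (rule is_ess_sup_le[OF ess[OF grid_le_T[OF q]] borel_measurable_cond_exp2])
        (use payoff_le[OF grid_le_T[OF q]] in blast)
    moreover have "AE \<omega> in M. real_cond_exp M (F q) (\<lambda>\<omega>. \<xi> \<omega> + U \<omega>) \<omega> = ?N q \<omega> + real_cond_exp M (F q) U \<omega>"
      by (intro sigma_finite_subalgebra.real_cond_exp_add[OF sigma_finite_subalgebra_F] L2_integrable \<xi> UL)
    moreover have "AE \<omega> in M. ?N q \<omega> \<le> Y q \<omega>"
      using value_ge_cond_exp[OF ess[OF grid_le_T[OF q]]] grid_le_T[OF q] by auto
    ultimately show ?thesis by eventually_elim simp
  qed
  then have "AE \<omega> in M. \<forall>q\<in>dyadic_grid T. \<bar>Y q \<omega> - ?N q \<omega>\<bar> \<le> \<bar>real_cond_exp M (F q) U \<omega>\<bar>"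
    using countable_dyadic_grid by (simp add: AE_ball_countable)
  then have "(\<integral>\<^sup>+\<omega>. (SUP q\<in>dyadic_grid T. ennreal ((Y q \<omega> - ?N q \<omega>)\<^sup>2)) \<partial>M)
      \<le> (\<integral>\<^sup>+\<omega>. (SUP q\<in>dyadic_grid T. ennreal ((real_cond_exp M (F q) U \<omega>)\<^sup>2)) \<partial>M)"
    by (intro nn_integral_mono_AE, eventually_elim)
      (intro SUP_mono, auto intro!: ennreal_leI simp: abs_le_square_iff)
  also note Doob_L2_cond_exp[OF UL]
  finally have "(\<integral>\<omega>. (?D \<omega>)\<^sup>2 \<partial>M) \<le> 4 * (\<integral>\<omega>. (U \<omega>)\<^sup>2 \<partial>M)"
    unfolding martingale_gap_def
    by (intro grid_max_L2(2)) (auto intro!: borel_measurable_diff S2c_measurable[OF Y] grid_le_T)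
  also have "(\<integral>\<omega>. (U \<omega>)\<^sup>2 \<partial>M) \<le> (\<integral>\<omega>. 1 / 16 * ((?D \<omega>)\<^sup>2 + (V \<omega>)\<^sup>2) \<partial>M)"
  proof (rule integral_mono[OF L2_square[OF UL]])
    show "integrable M (\<lambda>\<omega>. 1 / 16 * ((?D \<omega>)\<^sup>2 + (V \<omega>)\<^sup>2))"
      using L2_square[OF D] L2_square[OF V] by simp
    fix \<omega>
    have "(\<gamma>\<^sub>1 * d + \<gamma>\<^sub>2 * v)\<^sup>2 + (\<gamma>\<^sub>1 * v - \<gamma>\<^sub>2 * d)\<^sup>2 = (\<gamma>\<^sub>1\<^sup>2 + \<gamma>\<^sub>2\<^sup>2) * (d\<^sup>2 + v\<^sup>2)" for d v
      by (simp add: power2_eq_square algebra_simps)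
    then have "(\<gamma>\<^sub>1 * d + \<gamma>\<^sub>2 * v)\<^sup>2 \<le> (\<gamma>\<^sub>1\<^sup>2 + \<gamma>\<^sub>2\<^sup>2) * (d\<^sup>2 + v\<^sup>2)" for d v
      by (metis le_add_same_cancel1 zero_le_power2)
    also have "(\<gamma>\<^sub>1\<^sup>2 + \<gamma>\<^sub>2\<^sup>2) * (d\<^sup>2 + v\<^sup>2) \<le> 1 / 16 * (d\<^sup>2 + v\<^sup>2)" for d v
      using \<gamma>(3) by (intro mult_right_mono) auto
    finally show "(U \<omega>)\<^sup>2 \<le> 1 / 16 * ((?D \<omega>)\<^sup>2 + (V \<omega>)\<^sup>2)" by (simp add: U_def)
  qed
  finally show ?thesis using L2_square[OF D] L2_square[OF V] by simp
qed

section \<open>The mean-field value process\<close>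

text \<open>The existence of a continuous solution forces the terminal value to lie above the reward for
  stopping: stopping at the deterministic time \<open>t < T\<close> gives \<open>h (Y t) (E[Y t]) \<le> Y t\<close>, and \<open>t\<close>
  tends to \<open>T\<close>.\<close>

lemma mean_field_obstacle:
  assumes h: "small_lipschitz h \<gamma>\<^sub>1 \<gamma>\<^sub>2" and \<xi>: "\<xi> \<in> square_integrable_rvs M (F T)"
    and Y: "mean_field_system M T F h \<xi> Y"
  shows "AE \<omega> in M. Y T \<omega> = \<xi> \<omega>" "AE \<omega> in M. h (\<xi> \<omega>) (\<integral>\<omega>. \<xi> \<omega> \<partial>M) \<le> \<xi> \<omega>"
proof -
  interpret small_lipschitz h \<gamma>\<^sub>1 \<gamma>\<^sub>2 by (rule h)
  let ?H = "\<lambda>\<tau> \<omega>. h (Y (\<tau> \<omega>) \<omega>) (\<integral>\<omega>'. Y (\<tau> \<omega>') \<omega>' \<partial>M)"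
  have YS: "Y \<in> S2c M T F" using Y by (simp add: mean_field_system_def)
  have ess: "is_ess_sup M {real_cond_exp M (F t) (payoff T \<tau> (?H \<tau>) \<xi>) | \<tau>. \<tau> \<in> stopping_times M T F t} (Y t)"
    if "t \<in> {0..T}" for t using Y that by (simp add: mean_field_system_def)
  have \<xi>L: "\<xi> \<in> L2 M" and \<xi>F: "\<xi> \<in> borel_measurable (F T)"
    using \<xi> by (auto simp: square_integrable_rvs_def F_measurable)
  have TT: "T \<in> {0..T}" using T_pos by simp
  have \<xi>ce: "AE \<omega> in M. real_cond_exp M (F T) \<xi> \<omega> = \<xi> \<omega>"
    by (rule sigma_finite_subalgebra.real_cond_exp_F_meas[OF sigma_finite_subalgebra_F L2_integrable[OF \<xi>L] \<xi>F])
  have "AE \<omega> in M. real_cond_exp M (F T) (payoff T \<tau> (?H \<tau>) \<xi>) \<omega> \<le> \<xi> \<omega>"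
    if \<tau>: "\<tau> \<in> stopping_times M T F T" for \<tau>
  proof -
    have "AE \<omega> in M. T \<le> \<tau> \<omega> \<and> \<tau> \<omega> \<le> T" using \<tau> by (simp add: stopping_times_def)
    then have eq: "AE \<omega> in M. payoff T \<tau> (?H \<tau>) \<xi> \<omega> = \<xi> \<omega>"
      by eventually_elim (simp add: payoff_eq)
    have "payoff T \<tau> (?H \<tau>) \<xi> \<in> L2 M"
      by (intro payoff_L2 stopping_times_measurable[OF \<tau>] h_L2[OF prob_space_axioms] L2_const
          S2c_stopped(3)[OF YS \<tau> \<tau> TT] \<xi>L)
    then have "AE \<omega> in M. real_cond_exp M (F T) (payoff T \<tau> (?H \<tau>) \<xi>) \<omega> = real_cond_exp M (F T) \<xi> \<omega>"
      using eq \<xi>L by (intro sigma_finite_subalgebra.real_cond_exp_cong[OF sigma_finite_subalgebra_F]) (auto intro: L2_measurable)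
    with \<xi>ce show ?thesis by eventually_elim simp
  qed
  then have "AE \<omega> in M. Y T \<omega> \<le> \<xi> \<omega>"
    using ess[OF TT] L2_measurable[OF \<xi>L] unfolding is_ess_sup_def by auto
  with \<xi>ce value_ge_cond_exp[OF ess[OF TT]] show YT: "AE \<omega> in M. Y T \<omega> = \<xi> \<omega>"
    by (simp add: antisym_conv) (auto elim: AE_mp)
  \<comment> \<open>Deterministic times strictly before \<open>T\<close>, so that stopping there earns the reward and not \<open>\<xi>\<close>.\<close>
  define t where "t k = T * real (2 ^ k - 1) / 2 ^ k" for k :: nat
  have t_eq: "t k = T - T / 2 ^ k" for k
    by (simp add: t_def of_nat_diff field_simps)
  have t: "t k \<in> {0..T}" "t k < T" for k
  proof -
    have "T / 2 ^ k \<le> T / 1" using T_pos by (intro divide_left_mono) auto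
    moreover have "0 < T / 2 ^ k" using T_pos by simp
    ultimately show "t k \<in> {0..T}" "t k < T" unfolding t_eq by auto
  qed
  have t_lim: "t \<longlonglongrightarrow> T"
  proof -
    have "(\<lambda>k. T - T * (1 / 2) ^ k) \<longlonglongrightarrow> T - T * 0"
      by (intro tendsto_intros LIMSEQ_power_zero) simp
    then show ?thesis by (simp add: t_eq[abs_def] power_divide)
  qed
  have stop_now: "AE \<omega> in M. h (Y (t k) \<omega>) (\<integral>\<omega>. Y (t k) \<omega> \<partial>M) \<le> Y (t k) \<omega>" for k
  proof -
    let ?h = "\<lambda>\<omega>. h (Y (t k) \<omega>) (\<integral>\<omega>. Y (t k) \<omega> \<partial>M)"
    have "payoff T (\<lambda>_. t k) (?H (\<lambda>_. t k)) \<xi> = ?h" using t(2)[of k] by (auto simp: payoff_eq)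
    moreover have "(\<lambda>_. t k) \<in> stopping_times M T F (t k)"
      using t(2)[of k] by (intro const_stopping_times) auto
    ultimately have "AE \<omega> in M. real_cond_exp M (F (t k)) ?h \<omega> \<le> Y (t k) \<omega>"
      using ess[OF t(1)[of k]] unfolding is_ess_sup_def by force
    moreover have "AE \<omega> in M. real_cond_exp M (F (t k)) ?h \<omega> = ?h \<omega>"
      by (intro sigma_finite_subalgebra.real_cond_exp_F_meas[OF sigma_finite_subalgebra_F] h_measurable S2c_adapted[OF YS t(1)]
          L2_integrable h_L2[OF prob_space_axioms] S2c_L2[OF YS t(1)] L2_const) simp
    ultimately show ?thesis by eventually_elim simp
  qed
  have path_lim: "AE \<omega> in M. (\<lambda>k. Y (t k) \<omega>) \<longlonglongrightarrow> \<xi> \<omega>"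
    using S2c_continuous[OF YS] YT
  proof eventually_elim
    case (elim \<omega>)
    have "(\<lambda>k. Y (t k) \<omega>) \<longlonglongrightarrow> Y T \<omega>"
      by (rule continuous_on_tendsto_compose[OF elim(1) t_lim TT]) (use t(1) in auto)
    then show ?case by (simp add: elim(2))
  qed
  have mean_lim: "(\<lambda>k. \<integral>\<omega>. Y (t k) \<omega> \<partial>M) \<longlonglongrightarrow> (\<integral>\<omega>. \<xi> \<omega> \<partial>M)"
  proof (rule integral_dominated_convergence[OF _ _ L2_integrable[OF S2c_grid_max(1)[OF YS]] path_lim])
    show "AE \<omega> in M. norm (Y (t k) \<omega>) \<le> grid_max T Y \<omega>" for k
      using S2c_grid_max(2)[OF YS] by eventually_elim (use t(1)[of k] in auto)
  qed (use L2_measurable[OF \<xi>L] S2c_measurable[OF YS t(1)] in auto)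
  have "AE \<omega> in M. \<forall>k. h (Y (t k) \<omega>) (\<integral>\<omega>. Y (t k) \<omega> \<partial>M) \<le> Y (t k) \<omega>"
    using stop_now by (simp add: AE_all_countable)
  with path_lim show "AE \<omega> in M. h (\<xi> \<omega>) (\<integral>\<omega>. \<xi> \<omega> \<partial>M) \<le> \<xi> \<omega>"
  proof eventually_elim
    case (elim \<omega>)
    show ?case
      by (rule LIMSEQ_le[OF h_tendsto[OF elim(1) mean_lim] elim(1)]) (use elim(2) in auto)
  qed
qed

text \<open>Here the mean-field argument is the number \<open>E[Y\<^sub>\<tau>]\<close>. Optional stopping, applied to \<open>Y\<close> and to
  \<open>-Y\<close>, bounds its distance from \<open>E[\<xi>]\<close> by the mean of the gap \<open>D\<close>, so the general estimate reads
  \<open>E[D\<^sup>2] \<le> (E[D])\<^sup>2 / 3\<close> and leaves no room for a gap.\<close>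

lemma mean_field_value_is_martingale:
  assumes h: "small_lipschitz h \<gamma>\<^sub>1 \<gamma>\<^sub>2" and \<xi>: "\<xi> \<in> square_integrable_rvs M (F T)"
    and Y: "mean_field_system M T F h \<xi> Y"
  shows "AE \<omega> in M. \<forall>q\<in>dyadic_grid T. Y q \<omega> = real_cond_exp M (F q) \<xi> \<omega>"
proof -
  let ?N = "\<lambda>q. real_cond_exp M (F q) \<xi>" and ?D = "martingale_gap M F T Y \<xi>"
  let ?b = "\<integral>\<omega>. \<xi> \<omega> \<partial>M" and ?d = "\<integral>\<omega>. martingale_gap M F T Y \<xi> \<omega> \<partial>M"
  have YS: "Y \<in> S2c M T F" using Y by (simp add: mean_field_system_def)
  have \<xi>L: "\<xi> \<in> L2 M" using \<xi> by (auto simp: square_integrable_rvs_def F_measurable)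
  note D = martingale_gap_L2[OF YS \<xi>L]
  have mean: "\<bar>(\<integral>\<omega>. Y (\<tau> \<omega>) \<omega> \<partial>M) - ?b\<bar> \<le> ?d" if t: "t \<in> {0..T}" and \<tau>: "\<tau> \<in> stopping_times M T F t" for t \<tau>
  proof -
    have YL: "(\<lambda>\<omega>. Y (\<tau> \<omega>) \<omega>) \<in> L2 M" by (rule S2c_stopped(3)[OF YS \<tau> \<tau> t])
    \<comment> \<open>The sign \<open>c\<close> gives the upper and the lower bound at once.\<close>
    have bound: "(\<integral>\<omega>. c * Y (\<tau> \<omega>) \<omega> - c * \<xi> \<omega> \<partial>M) \<le> ?d" if c: "\<bar>c\<bar> = 1" for c :: real
    proof -
      have cN: "(\<lambda>\<omega>. c * ?N q \<omega>) \<in> L2 M" for q by (intro L2_cmult cond_exp_L2 \<xi>L)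
      have mart: "(\<integral>\<omega>. indicator A \<omega> * (c * ?N q \<omega>) \<partial>M) = (\<integral>\<omega>. indicator A \<omega> * (c * \<xi> \<omega>) \<partial>M)"
        if "A \<in> sets (F q)" for A q
        using cond_exp_indicator[OF \<xi>L that] by (simp add: mult.left_commute)
      have le: "AE \<omega> in M. c * Y q \<omega> \<le> c * ?N q \<omega> + ?D \<omega>" if "q \<in> dyadic_grid T" for q
        using D(2)
      proof eventually_elim
        case (elim \<omega>)
        have "c * (Y q \<omega> - ?N q \<omega>) \<le> \<bar>c * (Y q \<omega> - ?N q \<omega>)\<bar>" by simp
        also have "\<dots> = \<bar>Y q \<omega> - ?N q \<omega>\<bar>" by (simp add: abs_mult c)
        also have "\<dots> \<le> ?D \<omega>" using elim that by auto
        finally show ?case by (simp add: right_diff_distrib)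
      qed
      have lip: "\<bar>c * x - c * y\<bar> \<le> 1 * \<bar>x - y\<bar>" for x y
        using c by (simp add: right_diff_distrib[symmetric] abs_mult)
      have nn: "AE \<omega> in M. 0 \<le> ?D \<omega>" by (simp add: martingale_gap_nonneg)
      have "(\<integral>\<omega>. indicator (space M) \<omega> * (indicator {\<omega>. \<tau> \<omega> < T} \<omega> * (c * Y (\<tau> \<omega>) \<omega> - c * \<xi> \<omega>)) \<partial>M)
          \<le> (\<integral>\<omega>. indicator (space M) \<omega> * ?D \<omega> \<partial>M)"
        using F_space[of t] sets.top[of "F t"]
        by (intro optional_stopping_le[OF YS L2_integrable[OF L2_cmult[OF \<xi>L]] L2_integrable[OF cN] mart
              lip L2_integrable[OF D(1)] nn le t \<tau>]) auto
      also have "(\<integral>\<omega>. indicator (space M) \<omega> * ?D \<omega> \<partial>M) = ?d"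
        by (intro Bochner_Integration.integral_cong) auto
      also have "(\<integral>\<omega>. indicator (space M) \<omega> * (indicator {\<omega>. \<tau> \<omega> < T} \<omega> * (c * Y (\<tau> \<omega>) \<omega> - c * \<xi> \<omega>)) \<partial>M)
          = (\<integral>\<omega>. payoff T \<tau> (\<lambda>\<omega>. c * Y (\<tau> \<omega>) \<omega> - c * \<xi> \<omega>) (\<lambda>_. 0) \<omega> \<partial>M)"
        by (intro Bochner_Integration.integral_cong) (auto simp: payoff_eq indicator_def)
      also have "\<dots> = (\<integral>\<omega>. c * Y (\<tau> \<omega>) \<omega> - c * \<xi> \<omega> \<partial>M)"
      proof (rule integral_cong_AE)
        show "AE \<omega> in M. payoff T \<tau> (\<lambda>\<omega>. c * Y (\<tau> \<omega>) \<omega> - c * \<xi> \<omega>) (\<lambda>_. 0) \<omega> = c * Y (\<tau> \<omega>) \<omega> - c * \<xi> \<omega>"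
          using stopping_times_bounds[OF \<tau> t] mean_field_obstacle(1)[OF h \<xi> Y]
          by eventually_elim (auto simp: payoff_eq)
      qed (intro L2_measurable payoff_L2 L2_diff L2_cmult YL \<xi>L L2_const stopping_times_measurable[OF \<tau>])+
      finally show ?thesis .
    qed
    show ?thesis
      using bound[of 1] bound[of "-1"] L2_integrable[OF YL] L2_integrable[OF \<xi>L] by (simp add: abs_le_iff)
  qed
  have le: "(\<integral>\<omega>. (?D \<omega>)\<^sup>2 \<partial>M) \<le> 1 / 3 * (\<integral>\<omega>. ?d\<^sup>2 \<partial>M)"
  proof (rule martingale_gap_le[OF h YS \<xi>L L2_const mean_field_obstacle(2)[OF h \<xi> Y],
        where Z = "\<lambda>\<tau> _. \<integral>\<omega>. Y (\<tau> \<omega>) \<omega> \<partial>M"])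
    show "is_ess_sup M {real_cond_exp M (F t) (payoff T \<tau> (\<lambda>\<omega>. h (Y (\<tau> \<omega>) \<omega>) (\<integral>\<omega>. Y (\<tau> \<omega>) \<omega> \<partial>M)) \<xi>) | \<tau>.
        \<tau> \<in> stopping_times M T F t} (Y t)" if "t \<in> {0..T}" for t
      using Y that by (simp add: mean_field_system_def)
  qed (use mean in \<open>auto simp: L2_const\<close>)
  have "(\<integral>\<omega>. ?d\<^sup>2 \<partial>M) = ?d\<^sup>2" by (simp add: prob_space)
  then have "(\<integral>\<omega>. (?D \<omega>)\<^sup>2 \<partial>M) \<le> 0"
    using le L2_mean_sq_le[OF D(1)] by linarith
  moreover have "0 \<le> (\<integral>\<omega>. (?D \<omega>)\<^sup>2 \<partial>M)" by simp
  ultimately have "AE \<omega> in M. (?D \<omega>)\<^sup>2 = 0"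
    using integral_nonneg_eq_0_iff_AE[OF L2_square[OF D(1)]] by simp
  with D(2) show ?thesis by eventually_elim auto
qed

end

section \<open>Independence of the completed filtrations\<close>

lemma
  assumes "\<And>s. s \<in> {0..T} \<Longrightarrow> W s \<in> borel_measurable M"
  shows space_completed_filtration: "space (completed_filtration M T W t) = space M"
    and sets_completed_filtration: "sets (completed_filtration M T W t) = sigma_sets (space M)
      ({W s -` A \<inter> space M | s A. 0 \<le> s \<and> s \<le> min t T \<and> A \<in> sets borel} \<union> null_sets M)"
    and completed_filtration_subset: "{W s -` A \<inter> space M | s A. 0 \<le> s \<and> s \<le> min t T \<and> A \<in> sets borel} \<union> null_sets M \<subseteq> sets M"
proof -
  show sub: "{W s -` A \<inter> space M | s A. 0 \<le> s \<and> s \<le> min t T \<and> A \<in> sets borel} \<union> null_sets M \<subseteq> sets M"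
    using assms by (auto intro: measurable_sets)
  then have "{W s -` A \<inter> space M | s A. 0 \<le> s \<and> s \<le> min t T \<and> A \<in> sets borel} \<union> null_sets M \<subseteq> Pow (space M)"
    using sets.sets_into_space by blast
  then show "space (completed_filtration M T W t) = space M"
    "sets (completed_filtration M T W t) = sigma_sets (space M)
      ({W s -` A \<inter> space M | s A. 0 \<le> s \<and> s \<le> min t T \<and> A \<in> sets borel} \<union> null_sets M)"
    by (simp_all add: completed_filtration_def)
qed

lemma complete_filtered_space_completed_filtration:
  assumes "prob_space M" "complete_measure M" "0 < T" "\<And>s. s \<in> {0..T} \<Longrightarrow> W s \<in> borel_measurable M"
  shows "complete_filtered_space M (completed_filtration M T W) T"
proof -
  interpret prob_space M by fact
  interpret complete_measure M by fact
  have sets_eq: "sets (completed_filtration M T W t) = sigma_sets (space M)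
      ({W s -` A \<inter> space M | s A. 0 \<le> s \<and> s \<le> min t T \<and> A \<in> sets borel} \<union> null_sets M)" for t
    by (rule sets_completed_filtration) (rule assms(4))
  have space_eq: "space (completed_filtration M T W t) = space M" for t
    by (rule space_completed_filtration) (rule assms(4))
  show ?thesis
  proof
    have "sets (completed_filtration M T W t) \<subseteq> sets M" for t
      unfolding sets_eq by (rule sets.sigma_sets_subset, rule completed_filtration_subset) (rule assms(4))
    then show "subalgebra M (completed_filtration M T W t)" for t
      by (simp add: subalgebra_def space_eq)
    show "sets (completed_filtration M T W s) \<subseteq> sets (completed_filtration M T W t)" if "s \<le> t" for s t
      unfolding sets_eq using that by (intro sigma_sets_mono') fastforce
    show "null_sets M \<subseteq> sets (completed_filtration M T W t)" for t
      unfolding sets_eq by (auto intro: sigma_sets.Basic)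
  qed (rule assms(3))
qed

text \<open>Independence is insensitive to null sets, which is why completing the filtrations preserves it.\<close>

lemma (in prob_space) indep_sets_AE_eq:
  assumes indep: "indep_sets G I" and F: "\<And>i. i \<in> I \<Longrightarrow> F i \<subseteq> events"
    and eq: "\<And>i A. i \<in> I \<Longrightarrow> A \<in> F i \<Longrightarrow> \<exists>B\<in>G i. AE \<omega> in M. \<omega> \<in> A \<longleftrightarrow> \<omega> \<in> B"
  shows "indep_sets F I"
proof (rule indep_setsI[OF F])
  fix A J assume J: "J \<noteq> {}" "J \<subseteq> I" "finite J" and A: "\<forall>j\<in>J. A j \<in> F j"
  have "\<forall>j\<in>J. \<exists>B. B \<in> G j \<and> (AE \<omega> in M. \<omega> \<in> A j \<longleftrightarrow> \<omega> \<in> B)" using eq A J by blast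
  then obtain B where B: "\<And>j. j \<in> J \<Longrightarrow> B j \<in> G j" "\<And>j. j \<in> J \<Longrightarrow> AE \<omega> in M. \<omega> \<in> A j \<longleftrightarrow> \<omega> \<in> B j"
    by metis
  have Bev: "B j \<in> events" if "j \<in> J" for j
    using B(1)[OF that] indep J that by (auto simp: indep_sets_def)
  have Aev: "A j \<in> events" if "j \<in> J" for j using A F J that by blast
  have "AE \<omega> in M. \<forall>j\<in>J. \<omega> \<in> A j \<longleftrightarrow> \<omega> \<in> B j"
    using B(2) J(3) by (simp add: AE_finite_all)
  then have "AE \<omega> in M. \<omega> \<in> (\<Inter>j\<in>J. A j) \<longleftrightarrow> \<omega> \<in> (\<Inter>j\<in>J. B j)"
    by eventually_elim auto
  then have "prob (\<Inter>j\<in>J. A j) = prob (\<Inter>j\<in>J. B j)"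
    using J Aev Bev by (intro finite_measure_eq_AE sets.finite_INT) auto
  also have "\<dots> = (\<Prod>j\<in>J. prob (B j))"
    by (rule indep_setsD[OF indep J(2,1,3)]) (use B(1) in auto)
  also have "\<dots> = (\<Prod>j\<in>J. prob (A j))"
    using B(2) Aev Bev by (intro prod.cong refl finite_measure_eq_AE[symmetric]) auto
  finally show "prob (\<Inter>j\<in>J. A j) = (\<Prod>j\<in>J. prob (A j))" .
qed

text \<open>By induction over the generated sigma-algebra, every event of the completed filtration agrees
  almost surely with an event described by the path.\<close>

lemma (in prob_space) indep_completed_filtrations:
  assumes indep: "indep_processes M T W I"
    and W: "\<And>i s. i \<in> I \<Longrightarrow> s \<in> {0..T} \<Longrightarrow> W i s \<in> borel_measurable M"
  shows "indep_sets (\<lambda>i. sets (completed_filtration M T (W i) T)) I"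
proof -
  define X where "X i \<omega> = (\<lambda>t\<in>{0..T}. W i t \<omega>)" for i \<omega>
  let ?P = "Pi\<^sub>M {0..T} (\<lambda>_. borel :: real measure)"
  let ?G = "\<lambda>i. {X i -` B \<inter> space M | B. B \<in> sets ?P}"
  have X: "X i \<in> M \<rightarrow>\<^sub>M ?P" if "i \<in> I" for i
    unfolding X_def by (intro measurable_restrict W that)
  show ?thesis
  proof (rule indep_sets_AE_eq)
    show "indep_sets ?G I"
      using indep by (simp add: indep_processes_def indep_vars_def2 X_def[abs_def])
    fix i assume i: "i \<in> I"
    let ?g = "{W i s -` A \<inter> space M | s A. 0 \<le> s \<and> s \<le> min T T \<and> A \<in> sets borel} \<union> null_sets M"
    have sets_eq: "sets (completed_filtration M T (W i) T) = sigma_sets (space M) ?g"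
      by (rule sets_completed_filtration) (rule W[OF i])
    have sub: "?g \<subseteq> events" by (rule completed_filtration_subset) (rule W[OF i])
    show "sets (completed_filtration M T (W i) T) \<subseteq> events"
      unfolding sets_eq by (rule sets.sigma_sets_subset[OF sub])
    fix A assume "A \<in> sets (completed_filtration M T (W i) T)"
    then have "A \<in> sigma_sets (space M) ?g" unfolding sets_eq .
    then have "\<exists>B\<in>sets ?P. AE \<omega> in M. \<omega> \<in> A \<longleftrightarrow> \<omega> \<in> X i -` B \<inter> space M"
    proof induction
      case (Basic A)
      then consider (cyl) s C where "A = W i s -` C \<inter> space M" "s \<in> {0..T}" "C \<in> sets borel" | (null) "A \<in> null_sets M"
        by auto
      then show ?case
      proof cases
        case cyl
        let ?B = "(\<lambda>x. x s) -` C \<inter> space ?P"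
        have "?B \<in> sets ?P" by (rule measurable_sets[OF measurable_component_singleton[OF cyl(2)] cyl(3)])
        moreover have "A = X i -` ?B \<inter> space M"
          using cyl measurable_space[OF X[OF i]] by (auto simp: X_def)
        ultimately show ?thesis by (intro bexI[of _ ?B]) simp_all
      next
        case null
        then show ?thesis by (intro bexI[of _ "{}"]) (auto dest: AE_not_in)
      qed
    next
      case Empty
      then show ?case by (intro bexI[of _ "{}"]) auto
    next
      case (Compl A)
      then obtain B where B: "B \<in> sets ?P" "AE \<omega> in M. \<omega> \<in> A \<longleftrightarrow> \<omega> \<in> X i -` B \<inter> space M" by blast
      from B(2) AE_space have "AE \<omega> in M. \<omega> \<in> space M - A \<longleftrightarrow> \<omega> \<in> X i -` (space ?P - B) \<inter> space M"
        by eventually_elim (use measurable_space[OF X[OF i]] in auto)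
      with B(1) show ?case by (intro bexI[of _ "space ?P - B"]) auto
    next
      case (Union A)
      then have "\<forall>k. \<exists>B. B \<in> sets ?P \<and> (AE \<omega> in M. \<omega> \<in> A k \<longleftrightarrow> \<omega> \<in> X i -` B \<inter> space M)" by blast
      then obtain B where B: "\<And>k. B k \<in> sets ?P" "\<And>k. AE \<omega> in M. \<omega> \<in> A k \<longleftrightarrow> \<omega> \<in> X i -` B k \<inter> space M"
        by metis
      have "AE \<omega> in M. \<forall>k. \<omega> \<in> A k \<longleftrightarrow> \<omega> \<in> X i -` B k \<inter> space M"
        using B(2) by (simp add: AE_all_countable)
      then have "AE \<omega> in M. \<omega> \<in> (\<Union>k. A k) \<longleftrightarrow> \<omega> \<in> X i -` (\<Union>k. B k) \<inter> space M"
        by eventually_elim auto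
      with B(1) show ?case by (intro bexI[of _ "\<Union>k. B k"]) auto
    qed
    then show "\<exists>B\<in>?G i. AE \<omega> in M. \<omega> \<in> A \<longleftrightarrow> \<omega> \<in> B" by blast
  qed
qed

section \<open>Averages of independent martingales\<close>

locale independent_filtrations = prob_space M for M :: "'a measure" +
  fixes F :: "nat \<Rightarrow> real \<Rightarrow> 'a measure" and T :: real and n :: nat
  assumes filtered: "\<And>j. j \<in> {1..n} \<Longrightarrow> complete_filtered_space M (F j) T"
    and indep: "indep_sets (\<lambda>j. sets (F j T)) {1..n}"
    and n: "1 \<le> n"
begin

lemma F_subalgebra: "j \<in> {1..n} \<Longrightarrow> subalgebra M (F j q)"
  using complete_filtered_space.sub[OF filtered] by blast

lemma F_le_T: "j \<in> {1..n} \<Longrightarrow> q \<le> T \<Longrightarrow> sets (F j q) \<subseteq> sets (F j T)"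
  by (rule complete_filtered_space.F_mono[OF filtered])

lemma indep_vars_adapted:
  assumes "J \<subseteq> {1..n}" "\<And>j. j \<in> J \<Longrightarrow> X j \<in> borel_measurable (F j T)"
  shows "indep_vars (\<lambda>_. borel) X J"
  unfolding indep_vars_def2
proof
  show "\<forall>j\<in>J. random_variable borel (X j)"
    using assms measurable_from_subalg[OF F_subalgebra] by blast
  have "{X j -` A \<inter> space M | A. A \<in> sets borel} \<subseteq> sets (F j T)" if "j \<in> J" for j
    using measurable_sets[OF assms(2)[OF that]] F_subalgebra[of j T] assms(1) that
    by (auto simp: subalgebra_def)
  then show "indep_sets (\<lambda>j. {X j -` A \<inter> space M | A. A \<in> sets borel}) J"
    by (rule indep_sets_mono[OF indep assms(1)])
qed

text \<open>These rectangles generate the information of all particles at time \<open>q\<close> and are closed under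
  intersection, as Dynkin's theorem requires.\<close>

definition joint_sets :: "real \<Rightarrow> 'a set set" where
  "joint_sets q = {\<Inter>j\<in>{1..n}. A j | A. \<forall>j\<in>{1..n}. A j \<in> sets (F j q)}"

definition joint :: "real \<Rightarrow> 'a measure" where
  "joint q = sigma (space M) (joint_sets q)"

lemma joint_sets_events: "joint_sets q \<subseteq> events"
proof
  fix S assume "S \<in> joint_sets q"
  then obtain A where S: "S = (\<Inter>j\<in>{1..n}. A j)" and A: "\<And>j. j \<in> {1..n} \<Longrightarrow> A j \<in> sets (F j q)"
    by (auto simp: joint_sets_def)
  have "A j \<in> events" if "j \<in> {1..n}" for j using A[OF that] F_subalgebra[OF that, of q] by (auto simp: subalgebra_def)
  then show "S \<in> events" unfolding S using n by (intro sets.finite_INT) auto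
qed

lemma space_joint: "space (joint q) = space M"
  and sets_joint: "sets (joint q) = sigma_sets (space M) (joint_sets q)"
proof -
  have "joint_sets q \<subseteq> Pow (space M)" using joint_sets_events[of q] sets.sets_into_space by blast
  then show "space (joint q) = space M" "sets (joint q) = sigma_sets (space M) (joint_sets q)"
    by (simp_all add: joint_def)
qed

lemma joint_subalgebra: "subalgebra M (joint q)"
  by (simp add: subalgebra_def space_joint sets_joint sets.sigma_sets_subset[OF joint_sets_events])

lemma joint_mono:
  assumes "p \<le> q" shows "sets (joint p) \<subseteq> sets (joint q)"
proof -
  have "sets (F j p) \<subseteq> sets (F j q)" if "j \<in> {1..n}" for j
    by (rule complete_filtered_space.F_mono[OF filtered[OF that] assms])
  then show ?thesis
    unfolding sets_joint joint_sets_def by (intro sigma_sets_mono') blast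
qed

lemma F_le_joint:
  assumes j: "j \<in> {1..n}" shows "subalgebra (joint q) (F j q)"
proof -
  have "A \<in> sets (joint q)" if A: "A \<in> sets (F j q)" for A
  proof -
    let ?A = "\<lambda>l. if l = j then A else space M"
    have sp: "space M \<in> sets (F l q)" if "l \<in> {1..n}" for l
      using sets.top[of "F l q"] F_subalgebra[OF that, of q] unfolding subalgebra_def by metis
    have "A \<subseteq> space M" using sets.sets_into_space[OF A] F_subalgebra[OF j, of q] by (simp add: subalgebra_def)
    then have "A = (\<Inter>l\<in>{1..n}. ?A l)" using j by auto
    moreover have "\<forall>l\<in>{1..n}. ?A l \<in> sets (F l q)" using A sp by auto
    ultimately have "A \<in> joint_sets q" unfolding joint_sets_def by blast
    then show ?thesis by (simp add: sets_joint sigma_sets.Basic)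
  qed
  then show ?thesis using F_subalgebra[OF j, of q] by (auto simp: subalgebra_def space_joint)
qed

lemma Int_stable_joint_sets: "Int_stable (joint_sets q)"
proof (rule Int_stableI)
  fix S S' assume "S \<in> joint_sets q" "S' \<in> joint_sets q"
  then obtain A A' where A: "S = (\<Inter>j\<in>{1..n}. A j)" "\<forall>j\<in>{1..n}. A j \<in> sets (F j q)"
    "S' = (\<Inter>j\<in>{1..n}. A' j)" "\<forall>j\<in>{1..n}. A' j \<in> sets (F j q)"
    by (auto simp: joint_sets_def)
  have "S \<inter> S' = (\<Inter>j\<in>{1..n}. A j \<inter> A' j)" unfolding A(1,3) by blast
  moreover have "\<forall>j\<in>{1..n}. A j \<inter> A' j \<in> sets (F j q)" using A(2,4) by auto
  ultimately show "S \<inter> S' \<in> joint_sets q" unfolding joint_sets_def by blast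
qed

text \<open>An increment of the martingale of particle \<open>j\<close>, which is orthogonal to the past of that particle,
  stays orthogonal to the past of all particles. On a rectangle the expectation factorises by
  independence, and the factor of \<open>j\<close> vanishes.\<close>

lemma integral_increment_joint:
  fixes d :: "'a \<Rightarrow> real"
  assumes j: "j \<in> {1..n}" and q: "q \<le> T"
    and d: "d \<in> borel_measurable (F j T)" "integrable M d"
    and zero: "\<And>A. A \<in> sets (F j q) \<Longrightarrow> (\<integral>\<omega>. indicator A \<omega> * d \<omega> \<partial>M) = 0"
    and A: "A \<in> sets (joint q)"
  shows "(\<integral>\<omega>. indicator A \<omega> * d \<omega> \<partial>M) = 0"
proof -
  note int = integrable_indicator_times[OF d(2)]
  have ev: "B \<in> events" if "B \<in> sigma_sets (space M) (joint_sets q)" for B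
    using that sets.sigma_sets_subset[OF joint_sets_events] by blast
  have into: "joint_sets q \<subseteq> Pow (space M)" using joint_sets_events[of q] sets.sets_into_space by blast
  from A have "A \<in> sigma_sets (space M) (joint_sets q)" by (simp add: sets_joint)
  with Int_stable_joint_sets into show ?thesis
  proof (induction rule: sigma_sets_induct_disjoint)
    case (basic S)
    then obtain A where S: "S = (\<Inter>j\<in>{1..n}. A j)" and A: "\<And>j. j \<in> {1..n} \<Longrightarrow> A j \<in> sets (F j q)"
      by (auto simp: joint_sets_def)
    \<comment> \<open>The increment is attached to the factor of its own particle.\<close>
    define X where "X l \<omega> = (indicator (A l) \<omega> * (if l = j then d \<omega> else 1) :: real)" for l \<omega>
    have AT: "A l \<in> sets (F l T)" if "l \<in> {1..n}" for l using F_le_T[OF that q] A[OF that] by auto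
    have Aev: "A l \<in> events" if "l \<in> {1..n}" for l using AT[OF that] F_subalgebra[OF that, of T] by (auto simp: subalgebra_def)
    have "indicator S \<omega> * d \<omega> = (\<Prod>l\<in>{1..n}. X l \<omega>)" for \<omega>
    proof -
      have "(\<Prod>l\<in>{1..n}. X l \<omega>) = (\<Prod>l\<in>{1..n}. indicator (A l) \<omega>) * (\<Prod>l\<in>{1..n}. if l = j then d \<omega> else 1)"
        by (simp add: X_def prod.distrib)
      also have "(\<Prod>l\<in>{1..n}. if l = j then d \<omega> else 1) = d \<omega>" using j by simp
      also have "(\<Prod>l\<in>{1..n}. indicator (A l) \<omega>) = (indicator S \<omega> :: real)"
      proof (cases "\<omega> \<in> S")
        case True
        then show ?thesis unfolding S by (intro prod.neutral[THEN trans]) auto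
      next
        case False
        then obtain l where "l \<in> {1..n}" "\<omega> \<notin> A l" unfolding S by blast
        then have "(\<Prod>l\<in>{1..n}. indicator (A l) \<omega> :: real) = 0" by (intro prod_zero bexI[of _ l]) simp_all
        with False show ?thesis by simp
      qed
      finally show ?thesis by simp
    qed
    then have "(\<integral>\<omega>. indicator S \<omega> * d \<omega> \<partial>M) = (\<integral>\<omega>. (\<Prod>l\<in>{1..n}. X l \<omega>) \<partial>M)" by simp
    also have "\<dots> = (\<Prod>l\<in>{1..n}. \<integral>\<omega>. X l \<omega> \<partial>M)"
    proof (rule indep_vars_lebesgue_integral)
      show "indep_vars (\<lambda>_. borel) X {1..n}"
      proof (rule indep_vars_adapted)
        fix l assume "l \<in> {1..n}"
        then show "X l \<in> borel_measurable (F l T)"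
          using AT d(1) unfolding X_def[abs_def] by (cases "l = j") (auto intro: borel_measurable_times)
      qed simp
      show "integrable M (X l)" if "l \<in> {1..n}" for l
        using int[OF Aev[OF that]] integrable_indicator_times[of M "\<lambda>_. 1" "A l"] Aev[OF that]
        by (cases "l = j") (simp_all add: X_def[abs_def])
    qed simp
    also have "\<dots> = 0"
    proof (rule prod_zero)
      have "(\<integral>\<omega>. X j \<omega> \<partial>M) = 0" using zero[OF A[OF j]] by (simp add: X_def)
      then show "\<exists>l\<in>{1..n}. (\<integral>\<omega>. X l \<omega> \<partial>M) = 0" using j by blast
    qed simp
    finally show ?case .
  next
    case empty
    show ?case by simp
  next
    case (compl B)
    have "(\<integral>\<omega>. indicator (space M - B) \<omega> * d \<omega> \<partial>M) = (\<integral>\<omega>. d \<omega> - indicator B \<omega> * d \<omega> \<partial>M)"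
      using sets.sets_into_space[OF ev[OF compl(1)]]
      by (intro Bochner_Integration.integral_cong) (auto simp: indicator_def)
    also have "\<dots> = (\<integral>\<omega>. d \<omega> \<partial>M)"
      using compl int[OF ev[OF compl(1)]] d(2) by simp
    also have "\<dots> = (\<integral>\<omega>. indicator (space M) \<omega> * d \<omega> \<partial>M)"
      by (intro Bochner_Integration.integral_cong) auto
    also have "\<dots> = 0"
      using zero[of "space M"] sets.top[of "F j q"] F_subalgebra[OF j, of q] unfolding subalgebra_def by metis
    finally show ?case .
  next
    case (union B)
    have Bev: "B k \<in> events" for k using union(2) ev by blast
    have "(LINT \<omega>:(\<Union>k. B k)|M. d \<omega>) = (\<Sum>k. LINT \<omega>:B k|M. d \<omega>)"
    proof (rule lebesgue_integral_countable_add)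
      show "B i \<inter> B j = {}" if "i \<noteq> j" for i j
        using union(1) that by (auto simp: disjoint_family_on_def)
      show "set_integrable M (\<Union>k. B k) d"
        using int[of "\<Union>k. B k"] Bev by (simp add: set_integrable_def)
    qed (rule Bev)
    then show ?case using union(3) by (simp add: set_lebesgue_integral_def)
  qed
qed

lemma variance_sum_adapted:
  assumes x: "\<And>j. j \<in> {1..n} \<Longrightarrow> x j \<in> borel_measurable (F j T)" "\<And>j. j \<in> {1..n} \<Longrightarrow> x j \<in> L2 M"
    and mean: "\<And>j. j \<in> {1..n} \<Longrightarrow> (\<integral>\<omega>. x j \<omega> \<partial>M) = 0"
    and var: "\<And>j. j \<in> {1..n} \<Longrightarrow> (\<integral>\<omega>. (x j \<omega>)\<^sup>2 \<partial>M) \<le> v"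
  shows "(\<integral>\<omega>. (\<Sum>j=1..n. x j \<omega>)\<^sup>2 \<partial>M) \<le> real n * v"
proof -
  have cov: "(\<integral>\<omega>. x j \<omega> * x k \<omega> \<partial>M) = 0" if "j \<in> {1..n}" "k \<in> {1..n}" "j \<noteq> k" for j k
  proof -
    have "(\<integral>\<omega>. x j \<omega> * x k \<omega> \<partial>M) = (\<integral>\<omega>. (\<Prod>l\<in>{j, k}. x l \<omega>) \<partial>M)"
      using that(3) by simp
    also have "\<dots> = (\<Prod>l\<in>{j, k}. \<integral>\<omega>. x l \<omega> \<partial>M)"
    proof (rule indep_vars_lebesgue_integral)
      show "indep_vars (\<lambda>_. borel) x {j, k}"
        by (rule indep_vars_adapted) (use that x(1) in auto)
      show "integrable M (x l)" if "l \<in> {j, k}" for l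
        using that \<open>j \<in> {1..n}\<close> \<open>k \<in> {1..n}\<close> L2_integrable[OF x(2)] by blast
    qed simp
    also have "\<dots> = 0" using that mean by simp
    finally show ?thesis .
  qed
  have "(\<integral>\<omega>. (\<Sum>j=1..n. x j \<omega>)\<^sup>2 \<partial>M) = (\<integral>\<omega>. (\<Sum>j=1..n. \<Sum>k=1..n. x j \<omega> * x k \<omega>) \<partial>M)"
    by (simp add: power2_eq_square sum_product)
  also have "\<dots> = (\<Sum>j=1..n. \<integral>\<omega>. (\<Sum>k=1..n. x j \<omega> * x k \<omega>) \<partial>M)"
    by (intro Bochner_Integration.integral_sum Bochner_Integration.integrable_sum L2_mult_integrable x(2))
  also have "\<dots> = (\<Sum>j=1..n. \<Sum>k=1..n. \<integral>\<omega>. x j \<omega> * x k \<omega> \<partial>M)"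
    by (intro sum.cong refl Bochner_Integration.integral_sum L2_mult_integrable x(2))
  also have "\<dots> = (\<Sum>j=1..n. \<Sum>k=1..n. if j = k then \<integral>\<omega>. (x j \<omega>)\<^sup>2 \<partial>M else 0)"
    by (intro sum.cong refl) (auto simp: cov power2_eq_square)
  also have "\<dots> = (\<Sum>j=1..n. \<integral>\<omega>. (x j \<omega>)\<^sup>2 \<partial>M)" by simp
  also have "\<dots> \<le> real (card {1..n}) * v" by (intro sum_bounded_above var)
  finally show ?thesis by simp
qed

text \<open>A law of large numbers, uniform in time: the centred average of the martingales is a martingale in
  the joint filtration, so Doob's inequality bounds its maximum by the variance of its terminal
  value, which is of order \<open>1 / n\<close>.\<close>

lemma martingale_average_bound:
  assumes \<xi>: "\<And>j. j \<in> {1..n} \<Longrightarrow> \<xi> j \<in> square_integrable_rvs M (F j T)"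
    and mean: "\<And>j. j \<in> {1..n} \<Longrightarrow> (\<integral>\<omega>. \<xi> j \<omega> \<partial>M) = b"
    and var: "\<And>j. j \<in> {1..n} \<Longrightarrow> (\<integral>\<omega>. (\<xi> j \<omega> - b)\<^sup>2 \<partial>M) \<le> v"
  defines "S \<equiv> \<lambda>q \<omega>. 1 / real n * (\<Sum>j=1..n. real_cond_exp M (F j q) (\<xi> j) \<omega>) - b"
  shows "grid_max T S \<in> L2 M" "(\<integral>\<omega>. (grid_max T S \<omega>)\<^sup>2 \<partial>M) \<le> 4 * v / real n"
    "AE \<omega> in M. \<forall>q\<in>dyadic_grid T. \<bar>S q \<omega>\<bar> \<le> grid_max T S \<omega>"
proof -
  interpret F1: complete_filtered_space M "F 1" T using n by (intro filtered) auto
  let ?N = "\<lambda>j q. real_cond_exp M (F j q) (\<xi> j)"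
  have \<xi>F: "\<xi> j \<in> borel_measurable (F j T)" if "j \<in> {1..n}" for j
    using \<xi>[OF that] by (simp add: square_integrable_rvs_def)
  have \<xi>L: "\<xi> j \<in> L2 M" if "j \<in> {1..n}" for j
    using \<xi>[OF that] measurable_from_subalg[OF F_subalgebra[OF that] \<xi>F[OF that]]
    by (simp add: square_integrable_rvs_def)
  have NL: "?N j q \<in> L2 M" if "j \<in> {1..n}" for j q
    by (rule complete_filtered_space.cond_exp_L2[OF filtered \<xi>L]) (rule that)+
  define U where "U \<omega> = 1 / real n * (\<Sum>j=1..n. \<xi> j \<omega>) - b" for \<omega>
  have UL: "U \<in> L2 M"
    unfolding U_def by (intro L2_diff L2_cmult L2_sum L2_const \<xi>L)
  have SL: "S q \<in> L2 M" for q
    unfolding S_def by (intro L2_diff L2_cmult L2_sum L2_const NL)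
  have closed: "(\<integral>\<omega>. indicator A \<omega> * S q \<omega> \<partial>M) = (\<integral>\<omega>. indicator A \<omega> * U \<omega> \<partial>M)"
    if q: "q \<in> dyadic_grid T" and A: "A \<in> sets (joint q)" for q A
  proof -
    have qT: "q \<le> T" using F1.grid_le_T[OF q] by simp
    have Aev: "A \<in> events" using A joint_subalgebra[of q] by (auto simp: subalgebra_def)
    note ind = integrable_indicator_times[OF L2_integrable Aev]
    have dL: "(\<lambda>\<omega>. ?N j q \<omega> - \<xi> j \<omega>) \<in> L2 M" if "j \<in> {1..n}" for j
      by (intro L2_diff NL \<xi>L that)
    have zero: "(\<integral>\<omega>. indicator A \<omega> * (?N j q \<omega> - \<xi> j \<omega>) \<partial>M) = 0" if j: "j \<in> {1..n}" for j
    proof (rule integral_increment_joint[OF j qT _ L2_integrable[OF dL[OF j]] _ A])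
      have "subalgebra (F j T) (F j q)"
        using F_le_T[OF j qT] F_subalgebra[OF j] by (simp add: subalgebra_def)
      then show "(\<lambda>\<omega>. ?N j q \<omega> - \<xi> j \<omega>) \<in> borel_measurable (F j T)"
        by (rule borel_measurable_diff[OF measurable_from_subalg[OF _ borel_measurable_cond_exp] \<xi>F[OF j]])
      fix B assume B: "B \<in> sets (F j q)"
      then have Bev: "B \<in> events" using F_subalgebra[OF j, of q] by (auto simp: subalgebra_def)
      show "(\<integral>\<omega>. indicator B \<omega> * (?N j q \<omega> - \<xi> j \<omega>) \<partial>M) = 0"
        using complete_filtered_space.cond_exp_indicator[OF filtered[OF j] \<xi>L[OF j] B]
          integrable_indicator_times[OF L2_integrable[OF NL[OF j]] Bev] integrable_indicator_times[OF L2_integrable[OF \<xi>L[OF j]] Bev]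
        by (simp add: right_diff_distrib)
    qed
    have "(\<integral>\<omega>. indicator A \<omega> * S q \<omega> \<partial>M) - (\<integral>\<omega>. indicator A \<omega> * U \<omega> \<partial>M)
        = (\<integral>\<omega>. indicator A \<omega> * S q \<omega> - indicator A \<omega> * U \<omega> \<partial>M)"
      by (rule Bochner_Integration.integral_diff[symmetric]) (intro ind SL UL)+
    also have "\<dots> = (\<integral>\<omega>. 1 / real n * (\<Sum>j=1..n. indicator A \<omega> * (?N j q \<omega> - \<xi> j \<omega>)) \<partial>M)"
    proof (rule Bochner_Integration.integral_cong[OF refl])
      fix \<omega>
      have "(\<Sum>j=1..n. indicator A \<omega> * (?N j q \<omega> - \<xi> j \<omega>)) = indicator A \<omega> * ((\<Sum>j=1..n. ?N j q \<omega>) - (\<Sum>j=1..n. \<xi> j \<omega>))"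
        by (simp only: sum_distrib_left[symmetric] sum_subtractf)
      then show "indicator A \<omega> * S q \<omega> - indicator A \<omega> * U \<omega> = 1 / real n * (\<Sum>j=1..n. indicator A \<omega> * (?N j q \<omega> - \<xi> j \<omega>))"
        unfolding S_def U_def by (simp only: right_diff_distrib) (simp add: mult.left_commute)
    qed
    also have "\<dots> = 1 / real n * (\<integral>\<omega>. (\<Sum>j=1..n. indicator A \<omega> * (?N j q \<omega> - \<xi> j \<omega>)) \<partial>M)"
      by (rule integral_mult_right_zero)
    also have "(\<integral>\<omega>. (\<Sum>j=1..n. indicator A \<omega> * (?N j q \<omega> - \<xi> j \<omega>)) \<partial>M)
        = (\<Sum>j=1..n. \<integral>\<omega>. indicator A \<omega> * (?N j q \<omega> - \<xi> j \<omega>) \<partial>M)"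
      by (rule Bochner_Integration.integral_sum) (rule ind[OF dL])
    also have "\<dots> = 0" using zero by simp
    finally show ?thesis by simp
  qed
  have adapted: "S q \<in> borel_measurable (joint q)" for q
    unfolding S_def
    by (intro borel_measurable_diff borel_measurable_times borel_measurable_sum borel_measurable_const
        measurable_from_subalg[OF F_le_joint borel_measurable_cond_exp])
  have "(\<integral>\<omega>. (U \<omega>)\<^sup>2 \<partial>M) \<le> v / real n"
  proof -
    have "U \<omega> = 1 / real n * (\<Sum>j=1..n. \<xi> j \<omega> - b)" for \<omega>
      using n by (simp add: U_def sum_subtractf field_simps)
    then have "(\<integral>\<omega>. (U \<omega>)\<^sup>2 \<partial>M) = (1 / real n)\<^sup>2 * (\<integral>\<omega>. (\<Sum>j=1..n. \<xi> j \<omega> - b)\<^sup>2 \<partial>M)"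
      by (simp add: power_mult_distrib power_divide)
    also have "\<dots> \<le> (1 / real n)\<^sup>2 * (real n * v)"
    proof (intro mult_left_mono variance_sum_adapted)
      fix j assume j: "j \<in> {1..n}"
      show "(\<lambda>\<omega>. \<xi> j \<omega> - b) \<in> borel_measurable (F j T)" using \<xi>F[OF j] by simp
      show "(\<lambda>\<omega>. \<xi> j \<omega> - b) \<in> L2 M" by (intro L2_diff L2_const \<xi>L j)
      show "(\<integral>\<omega>. \<xi> j \<omega> - b \<partial>M) = 0" using mean[OF j] L2_integrable[OF \<xi>L[OF j]] by (simp add: prob_space)
      show "(\<integral>\<omega>. (\<xi> j \<omega> - b)\<^sup>2 \<partial>M) \<le> v" by (rule var[OF j])
    qed simp
    also have "\<dots> = v / real n" using n by (simp add: power2_eq_square field_simps)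
    finally show ?thesis .
  qed
  then have v: "ennreal (4 * (\<integral>\<omega>. (U \<omega>)\<^sup>2 \<partial>M)) \<le> ennreal (4 * v / real n)" by (intro ennreal_leI) simp
  have "(\<integral>\<^sup>+\<omega>. (SUP q\<in>dyadic_grid T. ennreal ((S q \<omega>)\<^sup>2)) \<partial>M) \<le> ennreal (4 * (\<integral>\<omega>. (U \<omega>)\<^sup>2 \<partial>M))"
    by (rule Doob_L2_grid[OF F1.T_pos joint_subalgebra joint_mono adapted SL UL closed])
  also note v
  finally have le: "(\<integral>\<^sup>+\<omega>. (SUP q\<in>dyadic_grid T. ennreal ((S q \<omega>)\<^sup>2)) \<partial>M) \<le> ennreal (4 * v / real n)" .
  have "0 \<le> (\<integral>\<omega>. (\<xi> 1 \<omega> - b)\<^sup>2 \<partial>M)" by simp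
  also have "\<dots> \<le> v" using n by (intro var) auto
  finally have "0 \<le> 4 * v / real n" by simp
  from grid_max_L2[OF L2_measurable[OF SL] this le] show "grid_max T S \<in> L2 M"
    "(\<integral>\<omega>. (grid_max T S \<omega>)\<^sup>2 \<partial>M) \<le> 4 * v / real n"
    "AE \<omega> in M. \<forall>q\<in>dyadic_grid T. \<bar>S q \<omega>\<bar> \<le> grid_max T S \<omega>" by auto
qed

end

context independent_filtrations
begin

text \<open>On the grid the empirical mean \<open>(1/n) \<Sum> Y j\<close> differs from \<open>b\<close> by at most the average of the gaps of
  all particles plus the maximum \<open>R\<close> of the centred average of the martingales; by continuity so it
  does at every random time. With \<open>d j\<close> for the second moment of the gap of \<open>j\<close>, the general estimate
  bounds every \<open>d j\<close> by \<open>(2 * a + 2 * E[R\<^sup>2]) / 3\<close> where \<open>a\<close> is the average of the \<open>d j\<close>. Averaging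
  over \<open>j\<close> gives \<open>a \<le> 2 * E[R\<^sup>2]\<close>, and this bounds each \<open>d j\<close>.\<close>

lemma interacting_gap_bound:
  assumes h: "small_lipschitz h \<gamma>\<^sub>1 \<gamma>\<^sub>2"
    and \<xi>: "\<And>j. j \<in> {1..n} \<Longrightarrow> \<xi> j \<in> square_integrable_rvs M (F j T)"
    and mean: "\<And>j. j \<in> {1..n} \<Longrightarrow> (\<integral>\<omega>. \<xi> j \<omega> \<partial>M) = b"
    and var: "\<And>j. j \<in> {1..n} \<Longrightarrow> (\<integral>\<omega>. (\<xi> j \<omega> - b)\<^sup>2 \<partial>M) \<le> v"
    and obstacle: "\<And>j. j \<in> {1..n} \<Longrightarrow> AE \<omega> in M. h (\<xi> j \<omega>) b \<le> \<xi> j \<omega>"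
    and Y: "interacting_system M T F h \<xi> n Y"
    and i: "i \<in> {1..n}"
  shows "(\<integral>\<omega>. (martingale_gap M (F i) T (Y i) (\<xi> i) \<omega>)\<^sup>2 \<partial>M) \<le> 8 * v / real n"
proof -
  let ?N = "\<lambda>j q. real_cond_exp M (F j q) (\<xi> j)"
  let ?D = "\<lambda>j. martingale_gap M (F j) T (Y j) (\<xi> j)"
  let ?avg = "\<lambda>x :: nat \<Rightarrow> real. 1 / real n * (\<Sum>j=1..n. x j)"
  note fs = filtered
  interpret Fi: complete_filtered_space M "F i" T by (rule fs[OF i])
  have YS: "Y j \<in> S2c M T (F j)" if "j \<in> {1..n}" for j
    using Y that by (auto simp: interacting_system_def)
  have \<xi>L: "\<xi> j \<in> L2 M" if j: "j \<in> {1..n}" for j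
    using \<xi>[OF j] complete_filtered_space.F_measurable[OF fs[OF j]]
    by (auto simp: square_integrable_rvs_def)
  have D: "?D j \<in> L2 M"
    "AE \<omega> in M. \<forall>q\<in>dyadic_grid T. \<bar>Y j q \<omega> - ?N j q \<omega>\<bar> \<le> ?D j \<omega>" if j: "j \<in> {1..n}" for j
    using complete_filtered_space.martingale_gap_L2[OF fs[OF j] YS[OF j] \<xi>L[OF j]] by blast+
  define S where "S q \<omega> = ?avg (\<lambda>j. ?N j q \<omega>) - b" for q \<omega>
  have R: "grid_max T S \<in> L2 M" "(\<integral>\<omega>. (grid_max T S \<omega>)\<^sup>2 \<partial>M) \<le> 4 * v / real n"
    "AE \<omega> in M. \<forall>q\<in>dyadic_grid T. \<bar>S q \<omega>\<bar> \<le> grid_max T S \<omega>"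
    unfolding S_def[abs_def] by (rule martingale_average_bound[OF \<xi> mean var]; assumption)+
  define V where "V \<omega> = ?avg (\<lambda>j. ?D j \<omega>) + grid_max T S \<omega>" for \<omega>
  have VL: "V \<in> L2 M"
    unfolding V_def by (intro L2_add L2_cmult L2_sum D R(1))
  have near: "AE \<omega> in M. \<forall>t\<in>{0..T}. \<bar>?avg (\<lambda>j. Y j t \<omega>) - b\<bar> \<le> V \<omega>"
  proof -
    have "AE \<omega> in M. \<forall>j\<in>{1..n}. continuous_on {0..T} (\<lambda>t. Y j t \<omega>)"
      using YS by (intro AE_finite_allI) (auto simp: S2c_def)
    moreover have "AE \<omega> in M. \<forall>j\<in>{1..n}. \<forall>q\<in>dyadic_grid T. \<bar>Y j q \<omega> - ?N j q \<omega>\<bar> \<le> ?D j \<omega>"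
      by (rule AE_finite_allI[OF finite_atLeastAtMost D(2)])
    ultimately show ?thesis using R(3)
    proof eventually_elim
      case (elim \<omega>)
      have cont: "continuous_on {0..T} (\<lambda>t. ?avg (\<lambda>j. Y j t \<omega>) - b)"
        using elim(1) by (intro continuous_intros) auto
      have grid: "\<bar>?avg (\<lambda>j. Y j q \<omega>) - b\<bar> \<le> V \<omega>" if q: "q \<in> dyadic_grid T" for q
      proof -
        have "?avg (\<lambda>j. Y j q \<omega>) - b = ?avg (\<lambda>j. Y j q \<omega> - ?N j q \<omega>) + S q \<omega>"
          by (simp add: S_def sum_subtractf right_diff_distrib)
        also have "\<bar>\<dots>\<bar> \<le> ?avg (\<lambda>j. \<bar>Y j q \<omega> - ?N j q \<omega>\<bar>) + \<bar>S q \<omega>\<bar>"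
          using sum_abs[of "\<lambda>j. Y j q \<omega> - ?N j q \<omega>" "{1..n}"]
          by (intro order_trans[OF abs_triangle_ineq] add_mono) (auto simp: abs_mult divide_right_mono)
        also have "\<dots> \<le> V \<omega>"
          unfolding V_def using elim(2,3) q by (intro add_mono mult_left_mono sum_mono) auto
        finally show ?thesis .
      qed
      show ?case using dyadic_grid_dense_le[OF Fi.T_pos cont grid] by simp
    qed
  qed
  have gap: "(\<integral>\<omega>. (?D i \<omega>)\<^sup>2 \<partial>M) \<le> 1 / 3 * (\<integral>\<omega>. (V \<omega>)\<^sup>2 \<partial>M)" if i: "i \<in> {1..n}" for i
  proof (rule complete_filtered_space.martingale_gap_le[OF fs[OF i] h YS[OF i] \<xi>L[OF i] VL obstacle[OF i],
        where Z = "\<lambda>\<tau> \<omega>. ?avg (\<lambda>j. Y j (\<tau> \<omega>) \<omega>)"])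
    fix t \<tau> assume t: "t \<in> {0..T}" and \<tau>: "\<tau> \<in> stopping_times M T (F i) t"
    note \<tau>m = complete_filtered_space.stopping_times_measurable[OF fs[OF i] \<tau>]
    note \<tau>b = complete_filtered_space.stopping_times_bounds[OF fs[OF i] \<tau> t]
    show "(\<lambda>\<omega>. ?avg (\<lambda>j. Y j (\<tau> \<omega>) \<omega>)) \<in> L2 M"
      by (intro L2_cmult L2_sum complete_filtered_space.S2c_at_random_time(3)[OF fs YS \<tau>m \<tau>b])
    show "AE \<omega> in M. \<bar>?avg (\<lambda>j. Y j (\<tau> \<omega>) \<omega>) - b\<bar> \<le> V \<omega>"
      using near \<tau>b by eventually_elim auto
  next
    fix t assume "t \<in> {0..T}"
    then show "is_ess_sup M {real_cond_exp M (F i t) (payoff T \<tau> (\<lambda>\<omega>. h (Y i (\<tau> \<omega>) \<omega>) (?avg (\<lambda>j. Y j (\<tau> \<omega>) \<omega>))) (\<xi> i)) | \<tau>.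
        \<tau> \<in> stopping_times M T (F i) t} (Y i t)"
      using Y i by (simp add: interacting_system_def)
  qed
  define d where "d j = (\<integral>\<omega>. (?D j \<omega>)\<^sup>2 \<partial>M)" for j
  have "(\<integral>\<omega>. (V \<omega>)\<^sup>2 \<partial>M) \<le> (\<integral>\<omega>. 2 * ?avg (\<lambda>j. (?D j \<omega>)\<^sup>2) + 2 * (grid_max T S \<omega>)\<^sup>2 \<partial>M)"
  proof (rule integral_mono[OF L2_square[OF VL]])
    show "integrable M (\<lambda>\<omega>. 2 * ?avg (\<lambda>j. (?D j \<omega>)\<^sup>2) + 2 * (grid_max T S \<omega>)\<^sup>2)"
      by (intro Bochner_Integration.integrable_add integrable_mult_right Bochner_Integration.integrable_sum
          L2_square D R(1))
    fix \<omega>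
    have "(?avg (\<lambda>j. ?D j \<omega>))\<^sup>2 \<le> (1 / real n)\<^sup>2 * ((\<Sum>j=1..n. (?D j \<omega>)\<^sup>2) * real n)"
      using sum_squared_le_sum_of_squares[of "\<lambda>j. ?D j \<omega>" "{1..n}"]
      unfolding power_mult_distrib by (intro mult_left_mono) auto
    also have "\<dots> = ?avg (\<lambda>j. (?D j \<omega>)\<^sup>2)" using n by (simp add: power2_eq_square field_simps)
    finally have "(?avg (\<lambda>j. ?D j \<omega>))\<^sup>2 \<le> ?avg (\<lambda>j. (?D j \<omega>)\<^sup>2)" .
    moreover have "(x + y)\<^sup>2 \<le> 2 * x\<^sup>2 + 2 * y\<^sup>2" for x y :: real
      using zero_le_power2[of "x - y"] by (simp add: power2_sum power2_diff)
    ultimately show "(V \<omega>)\<^sup>2 \<le> 2 * ?avg (\<lambda>j. (?D j \<omega>)\<^sup>2) + 2 * (grid_max T S \<omega>)\<^sup>2"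
      unfolding V_def by (smt (verit, best))
  qed
  also have "\<dots> = (\<integral>\<omega>. 2 * ?avg (\<lambda>j. (?D j \<omega>)\<^sup>2) \<partial>M) + (\<integral>\<omega>. 2 * (grid_max T S \<omega>)\<^sup>2 \<partial>M)"
    by (intro Bochner_Integration.integral_add integrable_mult_right Bochner_Integration.integrable_sum L2_square D R(1))
  also have "(\<integral>\<omega>. 2 * ?avg (\<lambda>j. (?D j \<omega>)\<^sup>2) \<partial>M) = 2 * (1 / real n * (\<integral>\<omega>. (\<Sum>j=1..n. (?D j \<omega>)\<^sup>2) \<partial>M))"
    by (simp only: integral_mult_right_zero)
  also have "(\<integral>\<omega>. (\<Sum>j=1..n. (?D j \<omega>)\<^sup>2) \<partial>M) = (\<Sum>j=1..n. d j)"
    unfolding d_def by (intro Bochner_Integration.integral_sum L2_square D)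
  also have "(\<integral>\<omega>. 2 * (grid_max T S \<omega>)\<^sup>2 \<partial>M) = 2 * (\<integral>\<omega>. (grid_max T S \<omega>)\<^sup>2 \<partial>M)"
    by (rule integral_mult_right_zero)
  finally have V_le: "(\<integral>\<omega>. (V \<omega>)\<^sup>2 \<partial>M) \<le> 2 * ?avg d + 2 * (4 * v / real n)"
    using R(2) by linarith
  have d_le: "d j \<le> 1 / 3 * (2 * ?avg d + 2 * (4 * v / real n))" if "j \<in> {1..n}" for j
    by (rule order_trans[OF gap[OF that, folded d_def] mult_left_mono[OF V_le]]) simp
  have "(\<Sum>j=1..n. d j) \<le> real (card {1..n}) * (1 / 3 * (2 * ?avg d + 2 * (4 * v / real n)))"
    by (rule sum_bounded_above) (rule d_le)
  then have "?avg d \<le> 1 / 3 * (2 * ?avg d + 2 * (4 * v / real n))"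
    using n by (simp add: divide_le_eq mult.commute)
  moreover have "z \<le> 2 * y" if "x \<le> 1 / 3 * (2 * x + 2 * y)" "z \<le> 1 / 3 * (2 * x + 2 * y)" for x y z :: real
  proof -
    have "3 * x \<le> 2 * x + 2 * y" "3 * z \<le> 2 * x + 2 * y" using that by simp_all
    then show ?thesis by linarith
  qed
  ultimately have "d i \<le> 2 * (4 * v / real n)" using d_le[OF i] by blast
  then show ?thesis by (simp add: d_def)
qed

end

section \<open>Convergence of the interacting system\<close>

lemma (in complete_filtered_space) sup_sq_expectation_diff_le:
  assumes X: "X \<in> S2c M T F" and Y: "Y \<in> S2c M T F" and \<xi>: "\<xi> \<in> L2 M"
    and mart: "AE \<omega> in M. \<forall>q\<in>dyadic_grid T. Y q \<omega> = real_cond_exp M (F q) \<xi> \<omega>"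
  shows "sup_sq_expectation M T (\<lambda>t \<omega>. X t \<omega> - Y t \<omega>) \<le> ennreal (\<integral>\<omega>. (martingale_gap M F T X \<xi> \<omega>)\<^sup>2 \<partial>M)"
proof -
  note D = martingale_gap_L2[OF X \<xi>]
  have "AE \<omega> in M. (SUP t\<in>{0..T}. ennreal (\<bar>X t \<omega> - Y t \<omega>\<bar>\<^sup>2)) \<le> ennreal ((martingale_gap M F T X \<xi> \<omega>)\<^sup>2)"
    using S2c_continuous[OF X] S2c_continuous[OF Y] D(2) mart
  proof eventually_elim
    case (elim \<omega>)
    have grid: "\<bar>X q \<omega> - Y q \<omega>\<bar> \<le> martingale_gap M F T X \<xi> \<omega>" if "q \<in> dyadic_grid T" for q
      using bspec[OF elim(3) that] bspec[OF elim(4) that] by simp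
    have "continuous_on {0..T} (\<lambda>t. X t \<omega> - Y t \<omega>)" by (rule continuous_on_diff[OF elim(1,2)])
    note le = dyadic_grid_dense_le[OF T_pos this grid]
    show ?case
      by (rule SUP_least, rule ennreal_leI, rule power_mono[OF le]) simp_all
  qed
  then have "sup_sq_expectation M T (\<lambda>t \<omega>. X t \<omega> - Y t \<omega>) \<le> (\<integral>\<^sup>+\<omega>. ennreal ((martingale_gap M F T X \<xi> \<omega>)\<^sup>2) \<partial>M)"
    unfolding sup_sq_expectation_def by (rule nn_integral_mono_AE)
  also have "\<dots> = ennreal (\<integral>\<omega>. (martingale_gap M F T X \<xi> \<omega>)\<^sup>2 \<partial>M)"
    using L2_square[OF D(1)] by (intro nn_integral_eq_integral) auto
  finally show ?thesis .
qed

theorem theorem3p3: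
  fixes M :: "'a measure"
    and T \<gamma>\<^sub>1 \<gamma>\<^sub>2 :: real
    and W :: "nat \<Rightarrow> real \<Rightarrow> 'a \<Rightarrow> real"
    and F :: "nat \<Rightarrow> real \<Rightarrow> 'a measure"
    and \<xi> :: "nat \<Rightarrow> 'a \<Rightarrow> real"
    and h :: "real \<Rightarrow> real \<Rightarrow> real"
    and Yn :: "nat \<Rightarrow> nat \<Rightarrow> real \<Rightarrow> 'a \<Rightarrow> real"
    and Y :: "nat \<Rightarrow> real \<Rightarrow> 'a \<Rightarrow> real"
  assumes "prob_space M" and "complete_measure M" and "T > 0"
    and "\<And>i. i \<ge> 1 \<Longrightarrow> brownian_motion M T (W i)"
    and "indep_processes M T W {1..}"
    and "\<And>i. i \<ge> 1 \<Longrightarrow> F i = completed_filtration M T (W i)"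
    and "\<And>i. i \<ge> 1 \<Longrightarrow> \<xi> i \<in> square_integrable_rvs M (F i T)"
    and "prob_space.indep_vars M (\<lambda>_. borel) \<xi> {1..}"
    and "\<And>i. i \<ge> 1 \<Longrightarrow> distr M borel (\<xi> i) = distr M borel (\<xi> 1)"
    and "\<gamma>\<^sub>1 > 0" and "\<gamma>\<^sub>2 > 0"
    and "\<And>y\<^sub>1 y\<^sub>2 z\<^sub>1 z\<^sub>2. \<bar>h y\<^sub>1 z\<^sub>1 - h y\<^sub>2 z\<^sub>2\<bar> \<le> \<gamma>\<^sub>1 * \<bar>y\<^sub>1 - y\<^sub>2\<bar> + \<gamma>\<^sub>2 * \<bar>z\<^sub>1 - z\<^sub>2\<bar>"
    and "\<gamma>\<^sub>1\<^sup>2 + \<gamma>\<^sub>2\<^sup>2 < 1 / 16"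
    and "\<And>n. n \<ge> 1 \<Longrightarrow> interacting_system M T F h \<xi> n (Yn n)"
    and "\<And>i. i \<ge> 1 \<Longrightarrow> mean_field_system M T (F i) h (\<xi> i) (Y i)"
  shows "(\<lambda>n. SUP i\<in>{1..n}. sup_sq_expectation M T (\<lambda>t \<omega>. Yn n i t \<omega> - Y i t \<omega>))
           \<longlonglongrightarrow> 0"
proof -
  interpret prob_space M by fact
  have h: "small_lipschitz h \<gamma>\<^sub>1 \<gamma>\<^sub>2" by unfold_locales (fact assms)+
  have W: "W i s \<in> borel_measurable M" if "1 \<le> i" "s \<in> {0..T}" for i s
    using assms(4)[OF that(1)] that(2) by (simp add: brownian_motion_def)
  have fs: "complete_filtered_space M (F i) T" if "1 \<le> i" for i
    unfolding assms(6)[OF that]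
    by (rule complete_filtered_space_completed_filtration[OF assms(1-3)]) (rule W[OF that])
  have "indep_sets (\<lambda>i. sets (completed_filtration M T (W i) T)) {1..}"
    by (rule indep_completed_filtrations[OF assms(5) W]) simp_all
  then have ind: "indep_sets (\<lambda>i. sets (F i T)) {1..n}" for n
  proof (rule indep_sets_mono)
    show "sets (F i T) \<subseteq> sets (completed_filtration M T (W i) T)" if "i \<in> {1..n}" for i
      using assms(6)[of i] that by simp
  qed auto
  have \<xi>L: "\<xi> i \<in> L2 M" if "1 \<le> i" for i
    using assms(7)[OF that] complete_filtered_space.F_measurable[OF fs[OF that]]
    by (auto simp: square_integrable_rvs_def)
  define b where "b = (\<integral>\<omega>. \<xi> 1 \<omega> \<partial>M)"
  define v where "v = (\<integral>\<omega>. (\<xi> 1 \<omega> - b)\<^sup>2 \<partial>M)"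
  have law: "(\<integral>\<omega>. f (\<xi> i \<omega>) \<partial>M) = (\<integral>\<omega>. f (\<xi> 1 \<omega>) \<partial>M)"
    if "1 \<le> i" "f \<in> borel_measurable borel" for i and f :: "real \<Rightarrow> real"
    using integral_distr[OF L2_measurable[OF \<xi>L[OF that(1)]] that(2)]
      integral_distr[OF L2_measurable[OF \<xi>L[of 1]] that(2)] assms(9)[OF that(1)] by simp
  have mean: "(\<integral>\<omega>. \<xi> i \<omega> \<partial>M) = b" if "1 \<le> i" for i
    using law[OF that, of "\<lambda>x. x"] by (simp add: b_def)
  have var: "(\<integral>\<omega>. (\<xi> i \<omega> - b)\<^sup>2 \<partial>M) = v" if "1 \<le> i" for i
    using law[OF that, of "\<lambda>x. (x - b)\<^sup>2"] by (simp add: v_def)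
  have obstacle: "AE \<omega> in M. h (\<xi> i \<omega>) b \<le> \<xi> i \<omega>" if "1 \<le> i" for i
    using complete_filtered_space.mean_field_obstacle(2)[OF fs[OF that] h assms(7)[OF that] assms(15)[OF that]]
    by (simp add: mean[OF that])
  have bound: "(SUP i\<in>{1..n}. sup_sq_expectation M T (\<lambda>t \<omega>. Yn n i t \<omega> - Y i t \<omega>)) \<le> ennreal (8 * v / real n)"
    if n: "1 \<le> n" for n
  proof (rule SUP_least)
    have filtered: "\<And>j. j \<in> {1..n} \<Longrightarrow> complete_filtered_space M (F j) T"
      using fs by simp
    interpret independent_filtrations M F T n
      by (intro independent_filtrations.intro independent_filtrations_axioms.intro prob_space_axioms
          filtered ind n)
    fix i assume i: "i \<in> {1..n}"
    then have i1: "1 \<le> i" by simp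
    have "sup_sq_expectation M T (\<lambda>t \<omega>. Yn n i t \<omega> - Y i t \<omega>)
        \<le> ennreal (\<integral>\<omega>. (martingale_gap M (F i) T (Yn n i) (\<xi> i) \<omega>)\<^sup>2 \<partial>M)"
    proof (rule complete_filtered_space.sup_sq_expectation_diff_le[OF fs[OF i1] _ _ \<xi>L[OF i1]])
      show "Yn n i \<in> S2c M T (F i)" using assms(14)[OF n] i by (simp add: interacting_system_def)
      show "Y i \<in> S2c M T (F i)" using assms(15)[OF i1] by (simp add: mean_field_system_def)
      show "AE \<omega> in M. \<forall>q\<in>dyadic_grid T. Y i q \<omega> = real_cond_exp M (F i q) (\<xi> i) \<omega>"
        by (rule complete_filtered_space.mean_field_value_is_martingale[OF fs[OF i1] h assms(7)[OF i1] assms(15)[OF i1]])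
    qed
    also have "\<dots> \<le> ennreal (8 * v / real n)"
    proof (rule ennreal_leI, rule interacting_gap_bound[OF h _ _ _ _ assms(14)[OF n] i])
      fix j assume "j \<in> {1..n}"
      then have j: "1 \<le> j" by simp
      show "\<xi> j \<in> square_integrable_rvs M (F j T)" by (rule assms(7)[OF j])
      show "(\<integral>\<omega>. \<xi> j \<omega> \<partial>M) = b" by (rule mean[OF j])
      show "(\<integral>\<omega>. (\<xi> j \<omega> - b)\<^sup>2 \<partial>M) \<le> v" by (rule eq_refl[OF var[OF j]])
      show "AE \<omega> in M. h (\<xi> j \<omega>) b \<le> \<xi> j \<omega>" by (rule obstacle[OF j])
    qed
    finally show "sup_sq_expectation M T (\<lambda>t \<omega>. Yn n i t \<omega> - Y i t \<omega>) \<le> ennreal (8 * v / real n)" .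
  qed
  have "(\<lambda>n. 8 * v / real n) \<longlonglongrightarrow> 0" by (rule lim_const_over_n)
  then have lim: "(\<lambda>n. ennreal (8 * v / real n)) \<longlonglongrightarrow> 0"
    using tendsto_ennrealI[of "\<lambda>n. 8 * v / real n" 0 sequentially] by simp
  show ?thesis
  proof (rule tendsto_sandwich[OF _ _ tendsto_const lim])
    show "\<forall>\<^sub>F n in sequentially. (SUP i\<in>{1..n}. sup_sq_expectation M T (\<lambda>t \<omega>. Yn n i t \<omega> - Y i t \<omega>)) \<le> ennreal (8 * v / real n)"
      using eventually_ge_at_top[of 1] by eventually_elim (rule bound)
  qed simp
qed

end
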